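(* Let $p\in(0,1]$ and $\psi\in L^p(\mathbb{R}^d)$, and assume that for each $\xi\in\mathbb{R}^d$ the periodization $P(e_\xi\psi)$ is not a.e. zero. Let $j>0$. Then $S_j:\ell^p(\mathbb{Z}^d)\to L^p(\mathbb{R}^d)$ is injective. If in addition $\psi$ has compact support, then $\|S_js\|_p\approx\|s\|_{\ell^p(\mathbb{Z}^d)}$, that is, $$\Big\|\sum_{k\in\mathbb{Z}^d}s_k\psi_{j,k}\Big\|_p\approx\Big(\sum_{k\in\mathbb{Z}^d}|s_k|^p\Big)^{1/p},\qquad s\in\ell^p(\mathbb{Z}^d)$$ (in other words, the collection $\{\psi_{j,k}:k\in\mathbb{Z}^d\}$ forms a $p$-Riesz basis for its span). Hence the range $S_j(\ell^p(\mathbb{Z}^d))$ is closed in $L^p(\mathbb{R}^d)$.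
   Context: Fix a dimension $d\in\mathbb{N}$. Functions and sequences are complex valued. Fix invertible real $d\times d$ matrices $a_j$ (integers $j>0$) with $\|a_j^{-1}\|\to0$ as $j\to\infty$ (operator norm), and an invertible real $d\times d$ matrix $b$. $\|f\|_p=(\int_{\mathbb{R}^d}|f|^p\,dx)^{1/p}$ and $\|s\|_{\ell^p(\mathbb{Z}^d)}=(\sum_{k\in\mathbb{Z}^d}|s_k|^p)^{1/p}$; $L^p(\mathbb{R}^d)$ has metric $\|f-g\|_p^p$. $\psi_{j,k}(x)=|\det a_j|^{1/p}\psi(a_jx-bk)$. Synthesis operator at scale $j$: $S_js=\sum_{k\in\mathbb{Z}^d}s_k\psi_{j,k}$ for $s=\{s_k\}_{k\in\mathbb{Z}^d}\in\ell^p(\mathbb{Z}^d)$ (the series converges absolutely a.e. to a function in $L^p$). $e_\xi(x)=e^{2\pi i\xi x}$, where $\xi\in\mathbb{R}^d$ is a row vector and $x\in\mathbb{R}^d$ a column vector. Periodization: $Pg(x)=|\det b|\sum_{k\in\mathbb{Z}^d}g(x-bk)$, which converges absolutely a.e. for $g\in L^p(\mathbb{R}^d)$, $p\in(0,1]$. $A(s)\approx B(s)$ means there are constants $C_1,C_2>0$, depending only on $\psi$, $b$ and $p$ (not on $s$ or $j$), with $C_1A(s)\le B(s)\le C_2A(s)$. *)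

theory Defs
  imports "HOL-Analysis.Analysis"
begin

definition Lp_fun :: "real \<Rightarrow> ('a::euclidean_space \<Rightarrow> complex) set" where
  "Lp_fun p = {f \<in> borel_measurable lebesgue. integrable lebesgue (\<lambda>x. norm (f x) powr p)}"

definition Lp_norm :: "real \<Rightarrow> ('a::euclidean_space \<Rightarrow> complex) \<Rightarrow> real" where
  "Lp_norm p f = (\<integral>x. norm (f x) powr p \<partial>lebesgue) powr (1 / p)"

definition ae_class :: "('a::euclidean_space \<Rightarrow> complex) \<Rightarrow> ('a \<Rightarrow> complex) set" where
  "ae_class f = {g \<in> borel_measurable lebesgue. AE x in lebesgue. g x = f x}"

text \<open>The space \<open>L\<^sup>p\<close> consists of almost-everywhere classes, so that the \<open>p\<close>-th power of the
  quasi-norm of a difference is a metric for \<open>0 < p \<le> 1\<close>. Its value does not depend on the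
  chosen representatives; see \<open>Lp_dist_ae_class\<close> and \<open>Metric_space_Lp\<close> below.\<close>

definition Lp :: "real \<Rightarrow> ('a::euclidean_space \<Rightarrow> complex) set set" where
  "Lp p = ae_class ` Lp_fun p"

definition Lp_dist ::
    "real \<Rightarrow> ('a::euclidean_space \<Rightarrow> complex) set \<Rightarrow> ('a \<Rightarrow> complex) set \<Rightarrow> real" where
  "Lp_dist p F G = (Lp_norm p (\<lambda>x. (SOME f. f \<in> F) x - (SOME g. g \<in> G) x)) powr p"

abbreviation Lp_topology :: "real \<Rightarrow> ('a::euclidean_space \<Rightarrow> complex) set topology" where
  "Lp_topology p \<equiv> Metric_space.mtopology (Lp p) (Lp_dist p)"

definition ell :: "real \<Rightarrow> ('k \<Rightarrow> complex) set" where
  "ell p = {s. (\<lambda>k. norm (s k) powr p) summable_on UNIV}"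

definition ell_norm :: "real \<Rightarrow> ('k \<Rightarrow> complex) \<Rightarrow> real" where
  "ell_norm p s = (\<Sum>\<^sub>\<infinity>k. norm (s k) powr p) powr (1 / p)"

definition compactly_supported :: "('a::euclidean_space \<Rightarrow> complex) \<Rightarrow> bool" where
  "compactly_supported f \<longleftrightarrow> (\<exists>K. compact K \<and> (AE x in lebesgue. x \<notin> K \<longrightarrow> f x = 0))"

definition lattice_point :: "int ^ 'n \<Rightarrow> real ^ 'n" where
  "lattice_point k = (\<chi> i. of_int (k $ i))"

text \<open>Only the matrices \<open>a j\<close> with \<open>j > 0\<close> are relevant; \<open>a 0\<close> is a dummy.\<close>

definition expanding_dilations :: "(nat \<Rightarrow> real ^ 'n ^ 'n) \<Rightarrow> bool" where
  "expanding_dilations a \<longleftrightarrow>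
     (\<forall>j>0. invertible (a j)) \<and> (\<lambda>j. onorm (\<lambda>x. matrix_inv (a j) *v x)) \<longlonglongrightarrow> 0"

definition affine_fun :: "real \<Rightarrow> (nat \<Rightarrow> real ^ 'n ^ 'n) \<Rightarrow> real ^ 'n ^ 'n \<Rightarrow>
    (real ^ 'n \<Rightarrow> complex) \<Rightarrow> nat \<Rightarrow> int ^ 'n \<Rightarrow> real ^ 'n \<Rightarrow> complex" where
  "affine_fun p a b \<psi> j k x =
     of_real (\<bar>det (a j)\<bar> powr (1 / p)) * \<psi> (a j *v x - b *v lattice_point k)"

definition synthesis :: "real \<Rightarrow> (nat \<Rightarrow> real ^ 'n ^ 'n) \<Rightarrow> real ^ 'n ^ 'n \<Rightarrow>
    (real ^ 'n \<Rightarrow> complex) \<Rightarrow> nat \<Rightarrow> (int ^ 'n \<Rightarrow> complex) \<Rightarrow> real ^ 'n \<Rightarrow> complex" where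
  "synthesis p a b \<psi> j s x = (\<Sum>\<^sub>\<infinity>k. s k * affine_fun p a b \<psi> j k x)"

definition Lp_synthesis :: "real \<Rightarrow> (nat \<Rightarrow> real ^ 'n ^ 'n) \<Rightarrow> real ^ 'n ^ 'n \<Rightarrow>
    (real ^ 'n \<Rightarrow> complex) \<Rightarrow> nat \<Rightarrow> (int ^ 'n \<Rightarrow> complex) \<Rightarrow> (real ^ 'n \<Rightarrow> complex) set" where
  "Lp_synthesis p a b \<psi> j s = ae_class (synthesis p a b \<psi> j s)"

definition character :: "real ^ 'n \<Rightarrow> real ^ 'n \<Rightarrow> complex" where
  "character \<xi> x = exp (2 * of_real pi * \<i> * of_real (\<xi> \<bullet> x))"

definition periodization ::
    "real ^ 'n ^ 'n \<Rightarrow> (real ^ 'n \<Rightarrow> complex) \<Rightarrow> real ^ 'n \<Rightarrow> complex" where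
  "periodization b g x = of_real \<bar>det b\<bar> * (\<Sum>\<^sub>\<infinity>k. g (x - b *v lattice_point k))"

lemma ae_class_self: "f \<in> borel_measurable lebesgue \<Longrightarrow> f \<in> ae_class f"
  by (simp add: ae_class_def)

lemma ae_class_eq_iff:
  assumes "f \<in> borel_measurable lebesgue"
  shows "ae_class f = ae_class g \<longleftrightarrow> (AE x in lebesgue. f x = g x)"
proof
  assume "ae_class f = ae_class g"
  then have "f \<in> ae_class g" using ae_class_self[OF assms] by simp
  then show "AE x in lebesgue. f x = g x" by (simp add: ae_class_def)
next
  assume fg: "AE x in lebesgue. f x = g x"
  have "(AE x in lebesgue. h x = f x) \<longleftrightarrow> (AE x in lebesgue. h x = g x)" for h :: "'a \<Rightarrow> complex"
  proof
    assume "AE x in lebesgue. h x = f x"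
    with fg show "AE x in lebesgue. h x = g x" by eventually_elim simp
  next
    assume "AE x in lebesgue. h x = g x"
    with fg show "AE x in lebesgue. h x = f x" by eventually_elim simp
  qed
  then show "ae_class f = ae_class g" by (simp add: ae_class_def)
qed

lemma powr_add_le_add_powr:
  fixes x y p :: real
  assumes "0 \<le> x" "0 \<le> y" "0 < p" "p \<le> 1"
  shows "(x + y) powr p \<le> x powr p + y powr p"
proof (cases "x + y = 0")
  case False
  then have pos: "0 < x + y" using assms by linarith
  have le: "t \<le> t powr p" if "0 \<le> t" "t \<le> 1" for t :: real
  proof (cases "t = 0")
    case False
    then show ?thesis using powr_mono'[of p 1 t] that assms by simp
  qed simp
  have "1 = x / (x + y) + y / (x + y)" using pos by (simp add: add_divide_distrib[symmetric])
  also have "\<dots> \<le> (x / (x + y)) powr p + (y / (x + y)) powr p"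
    by (intro add_mono le) (use assms pos in auto)
  also have "\<dots> = (x powr p + y powr p) / (x + y) powr p"
    using assms pos by (simp add: powr_divide add_divide_distrib)
  finally show ?thesis using pos by (simp add: le_divide_eq)
qed (use assms in auto)

lemma norm_diff_powr_le:
  fixes u v :: complex
  assumes "0 < p" "p \<le> 1"
  shows "norm (u - v) powr p \<le> norm u powr p + norm v powr p"
proof -
  have "norm (u - v) powr p \<le> (norm u + norm v) powr p"
    by (rule powr_mono2) (use assms norm_triangle_ineq4 in auto)
  also have "\<dots> \<le> norm u powr p + norm v powr p"
    by (rule powr_add_le_add_powr) (use assms in auto)
  finally show ?thesis .
qed

lemma Lp_fun_diff:
  fixes f g :: "'a::euclidean_space \<Rightarrow> complex"
  assumes p: "0 < p" "p \<le> 1" and f: "f \<in> Lp_fun p" and g: "g \<in> Lp_fun p"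
  shows "(\<lambda>x. f x - g x) \<in> Lp_fun p"
proof -
  have [measurable]: "f \<in> borel_measurable lebesgue" "g \<in> borel_measurable lebesgue"
    using f g by (auto simp: Lp_fun_def)
  have "integrable lebesgue (\<lambda>x. norm (f x) powr p + norm (g x) powr p)"
    using f g by (auto simp: Lp_fun_def)
  then have "integrable lebesgue (\<lambda>x. norm (f x - g x) powr p)"
    by (rule Bochner_Integration.integrable_bound) (use norm_diff_powr_le[OF p] in auto)
  then show ?thesis by (simp add: Lp_fun_def)
qed

lemma Lp_dist_ae_class:
  fixes f g :: "'a::euclidean_space \<Rightarrow> complex"
  assumes p: "0 < p" and f: "f \<in> borel_measurable lebesgue" and g: "g \<in> borel_measurable lebesgue"
  shows "Lp_dist p (ae_class f) (ae_class g) = (\<integral>x. norm (f x - g x) powr p \<partial>lebesgue)"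
proof -
  define f' where "f' = (SOME h. h \<in> ae_class f)"
  define g' where "g' = (SOME h. h \<in> ae_class g)"
  have f': "f' \<in> ae_class f" and g': "g' \<in> ae_class g"
    unfolding f'_def g'_def
    by (rule someI[of "\<lambda>h. h \<in> ae_class f", OF ae_class_self[OF f]],
        rule someI[of "\<lambda>h. h \<in> ae_class g", OF ae_class_self[OF g]])
  have [measurable]: "f' \<in> borel_measurable lebesgue" "g' \<in> borel_measurable lebesgue"
    using f' g' by (auto simp: ae_class_def)
  note [measurable] = f g
  have "AE x in lebesgue. f' x = f x" "AE x in lebesgue. g' x = g x"
    using f' g' by (auto simp: ae_class_def)
  then have "AE x in lebesgue. norm (f' x - g' x) powr p = norm (f x - g x) powr p"
    by eventually_elim simp
  then have "(\<integral>x. norm (f' x - g' x) powr p \<partial>lebesgue) = (\<integral>x. norm (f x - g x) powr p \<partial>lebesgue)"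
    by (intro integral_cong_AE) auto
  then show ?thesis
    using p by (simp add: Lp_dist_def Lp_norm_def f'_def[symmetric] g'_def[symmetric] powr_powr)
qed

lemma Metric_space_Lp:
  assumes p: "0 < p" "p \<le> 1"
  shows "Metric_space (Lp p :: ('a::euclidean_space \<Rightarrow> complex) set set) (Lp_dist p)"
proof
  fix F G :: "('a \<Rightarrow> complex) set"
  show "0 \<le> Lp_dist p F G" by (simp add: Lp_dist_def)
  show "Lp_dist p F G = Lp_dist p G F"
    by (simp add: Lp_dist_def Lp_norm_def norm_minus_commute)
next
  fix F G :: "('a \<Rightarrow> complex) set"
  assume "F \<in> Lp p" "G \<in> Lp p"
  then obtain f g where f: "F = ae_class f" "f \<in> Lp_fun p" and g: "G = ae_class g" "g \<in> Lp_fun p"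
    by (auto simp: Lp_def)
  have m: "f \<in> borel_measurable lebesgue" "g \<in> borel_measurable lebesgue"
    using f g by (auto simp: Lp_fun_def)
  have "integrable lebesgue (\<lambda>x. norm (f x - g x) powr p)"
    using Lp_fun_diff[OF p f(2) g(2)] by (simp add: Lp_fun_def)
  then have "Lp_dist p F G = 0 \<longleftrightarrow> (AE x in lebesgue. norm (f x - g x) powr p = 0)"
    using integral_nonneg_eq_0_iff_AE[of lebesgue "\<lambda>x. norm (f x - g x) powr p"]
    by (simp add: f g Lp_dist_ae_class[OF p(1) m])
  then show "Lp_dist p F G = 0 \<longleftrightarrow> F = G"
    by (simp add: f g ae_class_eq_iff[OF m(1)])
next
  fix F G H :: "('a \<Rightarrow> complex) set"
  assume "F \<in> Lp p" "G \<in> Lp p" "H \<in> Lp p"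
  then obtain f g h where f: "F = ae_class f" "f \<in> Lp_fun p" and g: "G = ae_class g" "g \<in> Lp_fun p"
    and h: "H = ae_class h" "h \<in> Lp_fun p"
    by (auto simp: Lp_def)
  have m: "f \<in> borel_measurable lebesgue" "g \<in> borel_measurable lebesgue" "h \<in> borel_measurable lebesgue"
    using f g h by (auto simp: Lp_fun_def)
  have i: "integrable lebesgue (\<lambda>x. norm (f x - g x) powr p)"
    "integrable lebesgue (\<lambda>x. norm (g x - h x) powr p)"
    "integrable lebesgue (\<lambda>x. norm (f x - h x) powr p)"
    using Lp_fun_diff[OF p f(2) g(2)] Lp_fun_diff[OF p g(2) h(2)] Lp_fun_diff[OF p f(2) h(2)]
    by (simp_all add: Lp_fun_def)
  have "norm (f x - h x) powr p \<le> norm (f x - g x) powr p + norm (g x - h x) powr p" for x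
    using norm_diff_powr_le[OF p, of "f x - g x" "h x - g x"] by (simp add: norm_minus_commute)
  then have "(\<integral>x. norm (f x - h x) powr p \<partial>lebesgue)
      \<le> (\<integral>x. norm (f x - g x) powr p + norm (g x - h x) powr p \<partial>lebesgue)"
    by (intro integral_mono) (use i in auto)
  then show "Lp_dist p F H \<le> Lp_dist p F G + Lp_dist p G H"
    using i by (simp add: f g h Lp_dist_ae_class[OF p(1)] m)
qed

end

theory Submission
  imports Defs
begin

text \<open>
  The substitution \<open>y = b\<^sup>-\<^sup>1 a\<^sub>j x\<close> removes \<open>a\<^sub>j\<close> and \<open>b\<close>: up to the factor
  \<open>|det a\<^sub>j|\<^sup>1\<^sup>/\<^sup>p\<close>, synthesis becomes \<open>\<Sum>\<^sub>k s\<^sub>k \<phi>(y - k)\<close> with \<open>\<phi>(y) = \<psi>(b y)\<close>. On the orbit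
  \<open>y + \<int>\<^sup>d\<close> this is the convolution of \<open>s\<close> with the sample \<open>f\<^sub>y(k) = \<phi>(y + k)\<close>, and the
  periodization hypothesis says that for each \<open>\<eta>\<close> the Fourier series of \<open>f\<^sub>y\<close> at \<open>\<eta>\<close> is nonzero
  for a non-null set of \<open>y\<close>. Hence a vanishing synthesis forces the Fourier series of \<open>s\<close> to vanish
  everywhere, which gives injectivity. If \<open>\<psi>\<close> has compact support, then the \<open>f\<^sub>y\<close> are trigonometric
  polynomials, and by compactness of the torus finitely many \<open>f\<^sub>y\<close> have no common zero. They can be
  deconvolved boundedly on \<open>\<ell>\<^sup>p\<close>, and since \<open>y\<close> may be taken to be an essential value of the map
  \<open>y \<mapsto> f\<^sub>y\<close>, the estimate persists on a set of positive measure around each \<open>y\<close>; integrating gives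
  the lower bound. A bounded-below operator on the complete space \<open>\<ell>\<^sup>p\<close> has closed range.
\<close>

section \<open>Sequence spaces\<close>

text \<open>For p < 1 the quasi-norms violate the triangle inequality, so the estimates concern
  their p-th powers \<open>ell_mass\<close> and \<open>Lp_mass\<close>, which are subadditive; on
  sequences the mass is also submultiplicative under convolution. The exponent 1/p returns only at
  the very end. The main obstacle is deconvolution inside the sequence space with p < 1: a supremum
  bound on a Fourier series controls each single coefficient but no sum of p-th powers. Finite
  support closes this gap. Powers of a trigonometric polynomial with supremum below 1 have
  exponentially small coefficients at polynomially many lattice points, so their masses tend to 0,
  and a finite geometric sum is an approximate inverse whose remainder can be absorbed. Essential
  values are forced by the fact that the generator and its synthesis matter only up to null sets:
  the equation at one point y carries no information. The factor \<open>|det a\<^sub>j|\<close> from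
  the normalisation cancels the Jacobian of the substitution up to \<open>|det b|\<close>; this
  makes the constants independent of j.\<close>

lemma infsum_norm_powr_le:
  fixes f :: "'k \<Rightarrow> complex"
  assumes p: "0 < p" "p \<le> 1" and f: "(\<lambda>k. norm (f k) powr p) summable_on A"
  shows "(\<lambda>k. norm (f k)) summable_on A"
    and "norm (infsum f A) powr p \<le> (\<Sum>\<^sub>\<infinity>k\<in>A. norm (f k) powr p)"
proof -
  let ?M = "\<Sum>\<^sub>\<infinity>k\<in>A. norm (f k) powr p"
  \<comment> \<open>Both conclusions rest on this finite inequality: its 1/p-th power bounds the
    absolute partial sums uniformly, and its limit over finite sets is the second claim.\<close>
  have powr_sum: "(\<Sum>k\<in>F. norm (f k)) powr p \<le> (\<Sum>k\<in>F. norm (f k) powr p)" if "finite F" for F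
    using that
  proof induction
    case (insert x F)
    have "(norm (f x) + (\<Sum>k\<in>F. norm (f k))) powr p \<le> norm (f x) powr p + (\<Sum>k\<in>F. norm (f k)) powr p"
      by (rule powr_add_le_add_powr) (use p in \<open>auto intro: sum_nonneg\<close>)
    with insert show ?case by simp
  qed simp
  have fin: "(\<Sum>k\<in>F. norm (f k)) powr p \<le> ?M" if "finite F" "F \<subseteq> A" for F
    using powr_sum[OF that(1)] finite_sum_le_infsum[OF f that] by fastforce
  show abs: "(\<lambda>k. norm (f k)) summable_on A"
  proof (rule nonneg_bdd_above_summable_on)
    show "bdd_above (sum (\<lambda>k. norm (f k)) ` {F. F \<subseteq> A \<and> finite F})"
    proof (rule bdd_aboveI2)
      fix F assume F: "F \<in> {F. F \<subseteq> A \<and> finite F}"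
      have "((\<Sum>k\<in>F. norm (f k)) powr p) powr (1/p) \<le> ?M powr (1/p)"
        using F fin p by (intro powr_mono2) auto
      then show "(\<Sum>k\<in>F. norm (f k)) \<le> ?M powr (1/p)"
        using p by (simp add: powr_powr sum_nonneg)
    qed
  qed auto
  have "(sum f \<longlongrightarrow> infsum f A) (finite_subsets_at_top A)"
    using abs_summable_summable[OF abs] by (rule infsum_tendsto)
  then have "((\<lambda>F. norm (sum f F) powr p) \<longlongrightarrow> norm (infsum f A) powr p) (finite_subsets_at_top A)"
    using p by (intro tendsto_powr' tendsto_norm tendsto_const) auto
  then show "norm (infsum f A) powr p \<le> ?M"
  proof (rule tendsto_upperbound)
    show "\<forall>\<^sub>F F in finite_subsets_at_top A. norm (sum f F) powr p \<le> ?M"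
    proof (rule eventually_finite_subsets_at_top_weakI)
      fix F assume F: "finite F" "F \<subseteq> A"
      have "norm (sum f F) powr p \<le> (\<Sum>k\<in>F. norm (f k)) powr p"
        using p by (intro powr_mono2 norm_sum) auto
      also have "\<dots> \<le> ?M" by (rule fin[OF F])
      finally show "norm (sum f F) powr p \<le> ?M" .
    qed
  qed simp
qed

text \<open>The p-th power of \<open>ell_norm\<close>, used in its place because for p at most 1 it
  satisfies the triangle inequality.\<close>

definition ell_mass :: "real \<Rightarrow> ('k \<Rightarrow> complex) \<Rightarrow> real" where
  "ell_mass p s = (\<Sum>\<^sub>\<infinity>k. norm (s k) powr p)"

lemma ell_mass_nonneg: "0 \<le> ell_mass p s"
  by (simp add: ell_mass_def infsum_nonneg)

lemma ell_abs_summable: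
  "0 < p \<Longrightarrow> p \<le> 1 \<Longrightarrow> s \<in> ell p \<Longrightarrow> (\<lambda>k. norm (s k)) summable_on UNIV"
  using infsum_norm_powr_le(1)[of p s UNIV] by (simp add: ell_def)

lemma ell_subset_ell_1: "0 < p \<Longrightarrow> p \<le> 1 \<Longrightarrow> s \<in> ell p \<Longrightarrow> s \<in> ell 1"
  using ell_abs_summable[of p s] by (simp add: ell_def)

lemma ell_1_iff: "s \<in> ell 1 \<longleftrightarrow> (\<lambda>k. norm (s k)) summable_on UNIV"
  by (simp add: ell_def)

lemma ell_diff:
  assumes p: "0 < p" "p \<le> 1" and "s \<in> ell p" "t \<in> ell p"
  shows "(\<lambda>k. s k - t k) \<in> ell p"
    and "ell_mass p (\<lambda>k. s k - t k) \<le> ell_mass p s + ell_mass p t"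
proof -
  have sum: "(\<lambda>k. norm (s k) powr p + norm (t k) powr p) summable_on UNIV"
    using assms by (intro summable_on_add) (auto simp: ell_def)
  then have *: "(\<lambda>k. norm (s k - t k) powr p) summable_on UNIV"
    by (rule summable_on_comparison_test) (auto intro: norm_diff_powr_le p)
  then show "(\<lambda>k. s k - t k) \<in> ell p" by (simp add: ell_def)
  have "ell_mass p (\<lambda>k. s k - t k) \<le> (\<Sum>\<^sub>\<infinity>k. norm (s k) powr p + norm (t k) powr p)"
    unfolding ell_mass_def by (rule infsum_mono[OF * sum]) (auto intro: norm_diff_powr_le p)
  also have "\<dots> = ell_mass p s + ell_mass p t"
    unfolding ell_mass_def using assms by (intro infsum_add) (auto simp: ell_def)
  finally show "ell_mass p (\<lambda>k. s k - t k) \<le> ell_mass p s + ell_mass p t" .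
qed

lemma ell_cmult:
  assumes "s \<in> ell p"
  shows "(\<lambda>k. c * s k) \<in> ell p" and "ell_mass p (\<lambda>k. c * s k) = norm c powr p * ell_mass p s"
  using assms by (simp_all add: ell_def ell_mass_def norm_mult powr_mult summable_on_cmult_right
      infsum_cmult_right')

lemma ell_zero: "(\<lambda>k. 0) \<in> ell p" "ell_mass p (\<lambda>k. 0) = 0"
  by (simp_all add: ell_def ell_mass_def)

lemma ell_add:
  assumes p: "0 < p" "p \<le> 1" and s: "s \<in> ell p" and t: "t \<in> ell p"
  shows "(\<lambda>k. s k + t k) \<in> ell p"
    and "ell_mass p (\<lambda>k. s k + t k) \<le> ell_mass p s + ell_mass p t"
  using ell_diff[OF p s ell_cmult(1)[OF t, of "-1"]] ell_cmult(2)[OF t, of "-1"] by simp_all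

lemma ell_sum:
  assumes p: "0 < p" "p \<le> 1" and s: "\<And>i. i \<in> I \<Longrightarrow> s i \<in> ell p"
  shows "(\<lambda>k. \<Sum>i\<in>I. s i k) \<in> ell p"
    and "ell_mass p (\<lambda>k. \<Sum>i\<in>I. s i k) \<le> (\<Sum>i\<in>I. ell_mass p (s i))"
proof -
  have "(\<lambda>k. \<Sum>i\<in>I. s i k) \<in> ell p \<and> ell_mass p (\<lambda>k. \<Sum>i\<in>I. s i k) \<le> (\<Sum>i\<in>I. ell_mass p (s i))"
    using s
  proof (induction I rule: infinite_finite_induct)
    case (insert i I)
    then have "s i \<in> ell p" "(\<lambda>k. \<Sum>i\<in>I. s i k) \<in> ell p"
      "ell_mass p (\<lambda>k. \<Sum>i\<in>I. s i k) \<le> (\<Sum>i\<in>I. ell_mass p (s i))" by auto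
    with ell_add[OF p this(1,2)] insert(1,2) show ?case by simp
  qed (simp_all add: ell_zero)
  then show "(\<lambda>k. \<Sum>i\<in>I. s i k) \<in> ell p"
    and "ell_mass p (\<lambda>k. \<Sum>i\<in>I. s i k) \<le> (\<Sum>i\<in>I. ell_mass p (s i))" by auto
qed

lemma finite_support_in_ell: "finite {k. s k \<noteq> 0} \<Longrightarrow> s \<in> ell p"
  unfolding ell_def by (auto intro!: finite_nonzero_values_imp_summable_on elim!: finite_subset[rotated])

lemma ell_mass_finite_support:
  assumes "finite K" "\<And>k. k \<notin> K \<Longrightarrow> s k = 0"
  shows "ell_mass p s = (\<Sum>k\<in>K. norm (s k) powr p)"
proof -
  have "ell_mass p s = (\<Sum>\<^sub>\<infinity>k\<in>K. norm (s k) powr p)"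
    unfolding ell_mass_def by (rule infsum_cong_neutral) (use assms in auto)
  with assms show ?thesis by simp
qed

section \<open>Convolution\<close>

definition conv :: "('g::ab_group_add \<Rightarrow> complex) \<Rightarrow> ('g \<Rightarrow> complex) \<Rightarrow> 'g \<Rightarrow> complex" where
  "conv s t m = (\<Sum>\<^sub>\<infinity>k. s k * t (m - k))"

lemma bij_shear_group: "bij (\<lambda>(m, k). (k, m - k :: 'g::ab_group_add))"
  by (rule bij_betw_byWitness[where f' = "\<lambda>(k, l). (k + l, k)"]) auto

text \<open>The map (m, k) to (k, m - k) turns the double sum of a convolution into a product of two
  sums. The value type is general because \<open>conv_ell\<close> needs real p-th powers and
  \<open>fourier_conv\<close> complex terms.\<close>

lemma summable_on_shear:
  fixes f g :: "'g::ab_group_add \<Rightarrow> 'b::{real_normed_field,banach}"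
  assumes "(\<lambda>k. norm (f k)) summable_on UNIV" "(\<lambda>k. norm (g k)) summable_on UNIV"
  shows "(\<lambda>(m, k). f k * g (m - k)) summable_on UNIV \<times> UNIV"
    and "(\<Sum>\<^sub>\<infinity>m. \<Sum>\<^sub>\<infinity>k. f k * g (m - k)) = infsum f UNIV * infsum g UNIV"
proof -
  have "(\<lambda>(k, l). norm (f k) * norm (g l)) summable_on UNIV \<times> UNIV"
    by (rule summable_on_SigmaI[where g = "\<lambda>k. norm (f k) * infsum (\<lambda>l. norm (g l)) UNIV"])
       (use assms in \<open>auto intro!: has_sum_cmult_right has_sum_infsum summable_on_cmult_left\<close>)
  then have "(\<lambda>z. norm (case z of (k, l) \<Rightarrow> f k * g l)) summable_on UNIV"
    by (simp add: norm_mult case_prod_unfold)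
  then have prod: "(\<lambda>(k, l). f k * g l) summable_on UNIV"
    by (rule abs_summable_summable)
  then have "(\<lambda>x. (\<lambda>(k, l). f k * g l) ((\<lambda>(m, k). (k, m - k)) x)) summable_on UNIV"
    by (subst summable_on_reindex_bij_betw[OF bij_shear_group])
  then show shear: "(\<lambda>(m, k). f k * g (m - k)) summable_on UNIV \<times> UNIV"
    by (simp add: case_prod_unfold)
  have "(\<Sum>\<^sub>\<infinity>m. \<Sum>\<^sub>\<infinity>k. f k * g (m - k)) = (\<Sum>\<^sub>\<infinity>(m, k). f k * g (m - k))"
    using infsum_Sigma'_banach[OF shear] by simp
  also have "\<dots> = (\<Sum>\<^sub>\<infinity>x. (\<lambda>(k, l). f k * g l) ((\<lambda>(m, k). (k, m - k)) x))"
    by (simp add: case_prod_unfold)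
  also have "\<dots> = (\<Sum>\<^sub>\<infinity>(k, l). f k * g l)"
    by (rule infsum_reindex_bij_betw[OF bij_shear_group])
  also have "\<dots> = (\<Sum>\<^sub>\<infinity>k. \<Sum>\<^sub>\<infinity>l. f k * g l)"
    using infsum_Sigma'_banach[of "\<lambda>k l. f k * g l" UNIV "\<lambda>_. UNIV"] prod by simp
  also have "\<dots> = infsum f UNIV * infsum g UNIV"
    by (simp add: infsum_cmult_right' infsum_cmult_left')
  finally show "(\<Sum>\<^sub>\<infinity>m. \<Sum>\<^sub>\<infinity>k. f k * g (m - k)) = infsum f UNIV * infsum g UNIV" .
qed

text \<open>A Young inequality for p at most 1: moving the p-th power inside the convolution sum
  only increases it, and what remains is the convolution of the two summable families of p-th
  powers.\<close>

lemma conv_ell: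
  assumes p: "0 < p" "p \<le> 1" and s: "s \<in> ell p" and t: "t \<in> ell p"
  shows "conv s t \<in> ell p" and "ell_mass p (conv s t) \<le> ell_mass p s * ell_mass p t"
proof -
  let ?f = "\<lambda>k. norm (s k) powr p" and ?g = "\<lambda>k. norm (t k) powr p"
  have *: "(\<lambda>k. norm (?f k)) summable_on UNIV" "(\<lambda>k. norm (?g k)) summable_on UNIV"
    using s t by (simp_all add: ell_def)
  note sh = summable_on_shear[OF *]
  have row: "(\<lambda>k. norm (s k * t (m - k)) powr p) summable_on UNIV" for m
    using summable_on_SigmaD1[OF sh(1), of m] by (simp add: norm_mult powr_mult)
  have le: "norm (conv s t m) powr p \<le> (\<Sum>\<^sub>\<infinity>k. ?f k * ?g (m - k))" for m
    using infsum_norm_powr_le(2)[OF p row[of m]] by (simp add: conv_def norm_mult powr_mult)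
  have outer: "(\<lambda>m. \<Sum>\<^sub>\<infinity>k. ?f k * ?g (m - k)) summable_on UNIV"
    using summable_on_Sigma_banach[OF sh(1)] by simp
  have c: "(\<lambda>m. norm (conv s t m) powr p) summable_on UNIV"
    by (rule summable_on_comparison_test[OF outer le]) auto
  then show "conv s t \<in> ell p" by (simp add: ell_def)
  have "ell_mass p (conv s t) \<le> (\<Sum>\<^sub>\<infinity>m. \<Sum>\<^sub>\<infinity>k. ?f k * ?g (m - k))"
    unfolding ell_mass_def by (rule infsum_mono[OF c outer le])
  also have "\<dots> = ell_mass p s * ell_mass p t"
    using sh(2) by (simp add: ell_mass_def)
  finally show "ell_mass p (conv s t) \<le> ell_mass p s * ell_mass p t" .
qed

section \<open>Fourier series on the integer lattice\<close>

lemma lattice_point_add: "lattice_point (k + l) = lattice_point k + lattice_point l"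
  and lattice_point_diff: "lattice_point (k - l) = lattice_point k - lattice_point l"
  and lattice_point_minus: "lattice_point (- k) = - lattice_point k"
  and lattice_point_0: "lattice_point 0 = 0"
  by (simp_all add: lattice_point_def vec_eq_iff)

lemma norm_character [simp]: "norm (character \<xi> x) = 1"
proof -
  have "character \<xi> x = exp (\<i> * of_real (2 * pi * (\<xi> \<bullet> x)))"
    by (simp add: character_def mult_ac)
  then show ?thesis by (simp only: norm_exp_i_times)
qed

lemma character_add: "character \<xi> (x + y) = character \<xi> x * character \<xi> y"
  by (simp add: character_def inner_add_right distrib_left exp_add)

lemma character_add_left: "character (\<xi> + \<eta>) x = character \<xi> x * character \<eta> x"
  by (simp add: character_def inner_add_left distrib_left exp_add)

lemma character_0 [simp]: "character \<xi> 0 = 1" "character 0 x = 1"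
  by (simp_all add: character_def)

lemma character_minus: "character \<xi> (- x) = cnj (character \<xi> x)"
  by (simp add: character_def exp_cnj)

lemma character_lattice: "character (lattice_point k) (lattice_point m) = 1"
proof -
  have "lattice_point k \<bullet> lattice_point m = of_int (\<Sum>i\<in>UNIV. k $ i * m $ i)"
    by (simp add: inner_vec_def lattice_point_def)
  moreover have "exp (2 * of_real pi * \<i> * of_real (of_int n)) = 1" for n
    using exp_integer_2pi[of "of_int n"] by (simp add: mult_ac)
  ultimately show ?thesis unfolding character_def by metis
qed

definition fourier :: "(int ^ 'n \<Rightarrow> complex) \<Rightarrow> real ^ 'n \<Rightarrow> complex" where
  "fourier s \<eta> = (\<Sum>\<^sub>\<infinity>k. s k * character \<eta> (lattice_point k))"

lemma fourier_summable:
  "s \<in> ell 1 \<Longrightarrow> (\<lambda>k. s k * character \<eta> (lattice_point k)) summable_on UNIV"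
  by (rule abs_summable_summable) (simp add: norm_mult ell_1_iff)

lemma fourier_finite_support:
  assumes "finite K" "\<And>k. k \<notin> K \<Longrightarrow> s k = 0"
  shows "fourier s \<eta> = (\<Sum>k\<in>K. s k * character \<eta> (lattice_point k))"
proof -
  have "fourier s \<eta> = (\<Sum>\<^sub>\<infinity>k\<in>K. s k * character \<eta> (lattice_point k))"
    unfolding fourier_def by (rule infsum_cong_neutral) (use assms in auto)
  with assms show ?thesis by simp
qed

lemma fourier_periodic: "fourier s (\<eta> + lattice_point k) = fourier s \<eta>"
  by (simp add: fourier_def character_add_left character_lattice)

lemma fourier_conv:
  assumes s: "s \<in> ell 1" and t: "t \<in> ell 1"
  shows "fourier (conv s t) \<eta> = fourier s \<eta> * fourier t \<eta>"
proof -
  let ?e = "\<lambda>k. character \<eta> (lattice_point k)"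
  have "fourier (conv s t) \<eta> = (\<Sum>\<^sub>\<infinity>m. \<Sum>\<^sub>\<infinity>k. (s k * ?e k) * (t (m - k) * ?e (m - k)))"
  proof -
    have "?e k * ?e (m - k) = ?e m" for k m
      using character_add[of \<eta> "lattice_point k" "lattice_point (m - k)"]
      by (simp add: lattice_point_diff)
    then have "(s k * ?e k) * (t (m - k) * ?e (m - k)) = s k * t (m - k) * ?e m" for k m
      by (metis mult.assoc mult.commute)
    then show ?thesis by (simp only: fourier_def conv_def infsum_cmult_left')
  qed
  also have "\<dots> = fourier s \<eta> * fourier t \<eta>"
    unfolding fourier_def
    by (rule summable_on_shear(2)) (use s t in \<open>auto simp: norm_mult ell_1_iff\<close>)
  finally show ?thesis .
qed

lemma fourier_add:
  "s \<in> ell 1 \<Longrightarrow> t \<in> ell 1 \<Longrightarrow> fourier (\<lambda>k. s k + t k) \<eta> = fourier s \<eta> + fourier t \<eta>"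
  unfolding fourier_def distrib_right by (intro infsum_add fourier_summable)

lemma fourier_cmult: "fourier (\<lambda>k. c * s k) \<eta> = c * fourier s \<eta>"
  by (simp add: fourier_def mult.assoc infsum_cmult_right')

lemma fourier_diff:
  "s \<in> ell 1 \<Longrightarrow> t \<in> ell 1 \<Longrightarrow> fourier (\<lambda>k. s k - t k) \<eta> = fourier s \<eta> - fourier t \<eta>"
  using fourier_add[of s "\<lambda>k. (-1) * t k" \<eta>] ell_cmult(1)[of t 1 "-1"] fourier_cmult[of "-1" t \<eta>]
  by simp

lemma fourier_sum:
  "(\<And>i. i \<in> I \<Longrightarrow> s i \<in> ell 1) \<Longrightarrow> fourier (\<lambda>k. \<Sum>i\<in>I. s i k) \<eta> = (\<Sum>i\<in>I. fourier (s i) \<eta>)"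
proof (induction I rule: infinite_finite_induct)
  case (insert i I)
  then show ?case using ell_sum(1)[of 1 I s] by (simp add: fourier_add)
qed (simp_all add: fourier_def)

text \<open>This involution supplies the conjugate factor: convolving a sequence with its image has
  the squared modulus as Fourier series, which is how sums of squares are realised in
  \<open>deconvolution\<close>.\<close>

lemma fourier_reflect_cnj: "fourier (\<lambda>k. cnj (s (- k))) \<eta> = cnj (fourier s \<eta>)"
proof -
  have "fourier (\<lambda>k. cnj (s (- k))) \<eta> = (\<Sum>\<^sub>\<infinity>k. cnj (s k) * character \<eta> (lattice_point (- k)))"
    unfolding fourier_def by (rule infsum_reindex_bij_witness[of _ uminus uminus]) auto
  also have "\<dots> = cnj (fourier s \<eta>)"
    by (simp add: fourier_def lattice_point_minus character_minus flip: infsum_cnj)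
  finally show ?thesis .
qed

section \<open>Coefficient bounds and uniqueness by discrete averaging\<close>

definition unit_seq :: "'g::zero \<Rightarrow> complex" where
  "unit_seq k = (if k = 0 then 1 else 0)"

lemma unit_seq_ell: "unit_seq \<in> ell p"
  by (rule finite_support_in_ell) (simp add: unit_seq_def)

lemma fourier_unit_seq: "fourier unit_seq \<eta> = 1"
  by (subst fourier_finite_support[of "{0}"]) (auto simp: unit_seq_def lattice_point_0)

text \<open>The summands are the powers of \<open>?w\<close>, an N-th root of unity. Either
  \<open>?w\<close> is 1, exactly when N divides d, or the geometric sum vanishes.\<close>

lemma sum_roots_of_unity:
  fixes d :: int
  assumes N: "N > 0"
  shows "(\<Sum>j<N. exp (2 * of_real pi * \<i> * of_real (real j / real N * of_int d)))
       = (if int N dvd d then of_nat N else 0 :: complex)"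
proof -
  let ?w = "exp (2 * of_real pi * \<i> * of_real (of_int d / real N)) :: complex"
  have pow: "exp (2 * of_real pi * \<i> * of_real (real j / real N * of_int d)) = ?w ^ j" for j
    by (simp add: exp_of_nat_mult [symmetric] mult_ac)
  have wN: "?w ^ N = 1"
    using N exp_integer_2pi[of "of_int d"] by (simp add: exp_of_nat_mult [symmetric] mult_ac)
  have w1: "?w = 1 \<longleftrightarrow> int N dvd d"
  proof
    assume "?w = 1"
    then obtain n :: int where "2 * pi * (of_int d / real N) = of_int (2 * n) * pi"
      by (auto simp: exp_eq_1)
    then have "of_int d = of_int n * real N" using N by (simp add: field_simps)
    then have "d = n * int N" by (metis of_int_eq_iff of_int_mult of_int_of_nat_eq)
    then show "int N dvd d" by simp
  next
    assume "int N dvd d"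
    then obtain n where "d = int N * n" by (elim dvdE)
    then show "?w = 1" using N exp_integer_2pi[of "of_int n"] by (simp add: mult_ac)
  qed
  show ?thesis
  proof (cases "?w = 1")
    case True
    then show ?thesis using w1 by (simp only: pow) simp
  next
    case False
    then have "(\<Sum>j<N. ?w ^ j) = 0" using geometric_sum[of ?w N] wN by simp
    then show ?thesis using False w1 by (simp only: pow) simp
  qed
qed

lemma infsum_finite_sum:
  fixes f :: "'i \<Rightarrow> 'k \<Rightarrow> complex"
  assumes "\<And>i. i \<in> I \<Longrightarrow> f i summable_on A"
  shows "(\<Sum>\<^sub>\<infinity>k\<in>A. \<Sum>i\<in>I. f i k) = (\<Sum>i\<in>I. infsum (f i) A)"
proof -
  have "(\<lambda>k. \<Sum>i\<in>I. f i k) summable_on A \<and> (\<Sum>\<^sub>\<infinity>k\<in>A. \<Sum>i\<in>I. f i k) = (\<Sum>i\<in>I. infsum (f i) A)"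
    using assms
    by (induction I rule: infinite_finite_induct) (auto simp: infsum_add intro!: summable_on_add)
  then show ?thesis by blast
qed

definition grid_point :: "nat \<Rightarrow> ('n \<Rightarrow> nat) \<Rightarrow> real ^ 'n" where
  "grid_point N j = (\<chi> i. real (j i) / real N)"

text \<open>The character factors over the coordinates, so the grid sum is a product of
  one-dimensional sums of roots of unity.\<close>

lemma sum_grid_character:
  fixes k :: "int ^ 'n"
  assumes "N > 0"
  shows "(\<Sum>j\<in>PiE UNIV (\<lambda>_. {..<N}). character (grid_point N j) (lattice_point k))
       = (if \<forall>i. int N dvd k $ i then of_nat (N ^ CARD('n)) else 0)"
proof -
  have "character (grid_point N j) (lattice_point k)
      = (\<Prod>i\<in>UNIV. exp (2 * of_real pi * \<i> * of_real (real (j i) / real N * of_int (k $ i))))" for j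
    by (simp add: character_def inner_vec_def lattice_point_def grid_point_def sum_distrib_left exp_sum)
  then have "(\<Sum>j\<in>PiE UNIV (\<lambda>_. {..<N}). character (grid_point N j) (lattice_point k))
     = (\<Prod>i\<in>UNIV. \<Sum>j<N. exp (2 * of_real pi * \<i> * of_real (real j / real N * of_int (k $ i))))"
    by (simp only:) (rule prod_sum_PiE[symmetric], auto)
  also have "\<dots> = (\<Prod>i\<in>UNIV. if int N dvd k $ i then of_nat N else 0)"
    by (simp only: sum_roots_of_unity[OF assms])
  also have "\<dots> = (if \<forall>i. int N dvd k $ i then of_nat (N ^ CARD('n)) else 0)"
    by auto
  finally show ?thesis .
qed

text \<open>Averaging over the grid \<open>(1/N) \<int>\<^sup>d\<close> isolates the coefficients congruent to \<open>m\<close> modulo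
  \<open>N\<close>; for large \<open>N\<close> all of them but the one at \<open>m\<close> lie in the tail.\<close>

lemma norm_coefficient_le_fourier:
  fixes t :: "int ^ 'n \<Rightarrow> complex"
  assumes t: "t \<in> ell 1" and B: "\<And>\<eta>. norm (fourier t \<eta>) \<le> B"
  shows "norm (t m) \<le> B"
proof (rule field_le_epsilon)
  fix \<epsilon> :: real assume \<epsilon>: "\<epsilon> > 0"
  have abs: "(\<lambda>k. norm (t k)) summable_on UNIV" using t by (simp add: ell_1_iff)
  have abs': "(\<lambda>k. norm (t k)) summable_on A" for A
    by (rule summable_on_subset[OF abs]) simp
  obtain F where F: "finite F" "dist (\<Sum>k\<in>F. norm (t k)) (\<Sum>\<^sub>\<infinity>k. norm (t k)) \<le> \<epsilon>"
    using infsum_finite_approximation[OF abs \<epsilon>] by blast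
  have tail: "(\<Sum>\<^sub>\<infinity>k\<in>-F. norm (t k)) \<le> \<epsilon>"
  proof -
    have "(\<Sum>\<^sub>\<infinity>k\<in>F \<union> -F. norm (t k)) = (\<Sum>\<^sub>\<infinity>k\<in>F. norm (t k)) + (\<Sum>\<^sub>\<infinity>k\<in>-F. norm (t k))"
      by (rule infsum_Un_disjoint) (auto intro: abs')
    then show ?thesis using F by (simp add: dist_real_def abs_le_iff)
  qed
  \<comment> \<open>N exceeds every coordinate distance from m to a point of F; the added 1 makes
    this strict and N positive. Hence no point of F other than m can be congruent to m modulo
    N.\<close>
  define N where "N = nat (1 + (\<Sum>k\<in>F. \<Sum>i\<in>UNIV. \<bar>k $ i - m $ i\<bar>))"
  have N0: "N > 0"
    unfolding N_def by (simp add: sum_nonneg add_pos_nonneg)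
  have N: "\<bar>k $ i - m $ i\<bar> < int N" if "k \<in> F" for k i
  proof -
    have "\<bar>k $ i - m $ i\<bar> \<le> (\<Sum>i\<in>UNIV. \<bar>k $ i - m $ i\<bar>)"
      by (rule member_le_sum) auto
    also have "\<dots> \<le> (\<Sum>k\<in>F. \<Sum>i\<in>UNIV. \<bar>k $ i - m $ i\<bar>)"
      by (rule member_le_sum) (use F that in \<open>auto intro: sum_nonneg\<close>)
    finally show ?thesis unfolding N_def by simp
  qed
  define C where "C = {k::int ^ 'n. \<forall>i. int N dvd (k - m) $ i}"
  have CF: "k = m" if "k \<in> C" "k \<in> F" for k
  proof -
    have "(k - m) $ i = 0" for i
      using that N[of k i] zdvd_not_zless[of "\<bar>(k - m) $ i\<bar>" "int N"] unfolding C_def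
      by (auto simp: not_less)
    then show ?thesis by (simp add: vec_eq_iff)
  qed
  let ?J = "PiE (UNIV :: 'n set) (\<lambda>_. {..<N})"
  let ?D = "of_nat (N ^ CARD('n)) :: complex"
  have J: "finite ?J" "card ?J = N ^ CARD('n)"
    by (auto simp: card_PiE intro!: finite_PiE)
  \<comment> \<open>Discrete Fourier inversion: after exchanging the finite grid sum with the
    series, the sum of the character at k - m is \<open>?D\<close> on the residue class C and 0 off
    it.\<close>
  have avg: "(\<Sum>j\<in>?J. fourier t (grid_point N j) * character (grid_point N j) (lattice_point (- m)))
      = ?D * infsum t C"
  proof -
    have "(\<Sum>j\<in>?J. fourier t (grid_point N j) * character (grid_point N j) (lattice_point (- m)))
        = (\<Sum>j\<in>?J. \<Sum>\<^sub>\<infinity>k. t k * character (grid_point N j) (lattice_point (k - m)))"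
    proof (rule sum.cong[OF refl])
      fix j
      have "character (grid_point N j) (lattice_point (k - m))
        = character (grid_point N j) (lattice_point k) * character (grid_point N j) (lattice_point (- m))" for k
        using character_add[of "grid_point N j" "lattice_point k" "lattice_point (- m)"]
        by (simp flip: lattice_point_add)
      then show "fourier t (grid_point N j) * character (grid_point N j) (lattice_point (- m))
        = (\<Sum>\<^sub>\<infinity>k. t k * character (grid_point N j) (lattice_point (k - m)))"
        by (simp add: fourier_def flip: infsum_cmult_left' mult.assoc)
    qed
    also have "\<dots> = (\<Sum>\<^sub>\<infinity>k. \<Sum>j\<in>?J. t k * character (grid_point N j) (lattice_point (k - m)))"
      by (rule infsum_finite_sum[symmetric], rule abs_summable_summable) (simp add: norm_mult abs)
    also have "\<dots> = (\<Sum>\<^sub>\<infinity>k\<in>C. ?D * t k)"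
    proof (rule infsum_cong_neutral)
      fix k
      show "(\<Sum>j\<in>?J. t k * character (grid_point N j) (lattice_point (k - m))) = ?D * t k"
        if "k \<in> UNIV \<inter> C"
        using that unfolding C_def
        by (simp add: sum_grid_character[OF N0] flip: sum_distrib_left)
      show "(\<Sum>j\<in>?J. t k * character (grid_point N j) (lattice_point (k - m))) = 0"
        if "k \<in> UNIV - C"
        using that unfolding C_def
        by (auto simp add: sum_grid_character[OF N0] simp flip: sum_distrib_left)
    qed auto
    also have "\<dots> = ?D * infsum t C" by (rule infsum_cmult_right')
    finally show ?thesis .
  qed
  have "norm ?D * norm (infsum t C) \<le> real (N ^ CARD('n)) * B"
  proof -
    have "norm (\<Sum>j\<in>?J. fourier t (grid_point N j) * character (grid_point N j) (lattice_point (- m)))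
        \<le> (\<Sum>j\<in>?J. B)"
      by (rule sum_norm_le) (simp add: norm_mult B)
    then show ?thesis unfolding avg by (simp add: norm_mult J)
  qed
  then have C_le: "norm (infsum t C) \<le> B"
    using N0 by (simp del: of_nat_power)
  have "infsum t ({m} \<union> (C - {m})) = infsum t {m} + infsum t (C - {m})"
    by (rule infsum_Un_disjoint) (auto intro: abs_summable_summable abs')
  moreover have "{m} \<union> (C - {m}) = C" by (auto simp: C_def)
  ultimately have "t m = infsum t C - infsum t (C - {m})" by simp
  then have "norm (t m) \<le> norm (infsum t C) + norm (infsum t (C - {m}))"
    by (metis norm_triangle_ineq4)
  also have "norm (infsum t (C - {m})) \<le> (\<Sum>\<^sub>\<infinity>k\<in>C - {m}. norm (t k))"
    by (rule norm_infsum_bound) (rule abs')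
  also have "\<dots> \<le> (\<Sum>\<^sub>\<infinity>k\<in>-F. norm (t k))"
    by (rule infsum_mono2) (use CF in \<open>auto intro: abs'\<close>)
  finally show "norm (t m) \<le> B + \<epsilon>" using C_le tail by linarith
qed

text \<open>The coefficient bound with B = 0, applied to the difference. From here on, identities
  between convolutions are checked as identities between products of functions.\<close>

lemma fourier_inj:
  assumes "s \<in> ell 1" "t \<in> ell 1" and "\<And>\<eta>. fourier s \<eta> = fourier t \<eta>"
  shows "s = t"
proof
  fix m
  have "norm (s m - t m) \<le> 0"
    using norm_coefficient_le_fourier[of "\<lambda>k. s k - t k" 0 m] ell_diff(1)[of 1 s t] assms
    by (simp add: fourier_diff)
  then show "s m = t m" by simp
qed

lemma conv_commute: "s \<in> ell 1 \<Longrightarrow> t \<in> ell 1 \<Longrightarrow> conv s t = conv t s"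
  for s t :: "int ^ 'n \<Rightarrow> complex"
  by (rule fourier_inj) (auto intro: conv_ell simp: fourier_conv)

lemma conv_nonzeroD: "conv s t m \<noteq> 0 \<Longrightarrow> \<exists>k. s k \<noteq> 0 \<and> t (m - k) \<noteq> 0"
  unfolding conv_def by (metis (mono_tags, lifting) infsum_0 mult_eq_0_iff)

lemma conv_finite_support:
  fixes s t :: "'g::ab_group_add \<Rightarrow> complex"
  assumes "finite {k. s k \<noteq> 0}" "finite {k. t k \<noteq> 0}"
  shows "finite {k. conv s t k \<noteq> 0}"
proof (rule finite_subset)
  show "{k. conv s t k \<noteq> 0} \<subseteq> (\<lambda>(k, l). k + l) ` ({k. s k \<noteq> 0} \<times> {k. t k \<noteq> 0})"
  proof clarify
    fix m assume "conv s t m \<noteq> 0"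
    then obtain k where "s k \<noteq> 0" "t (m - k) \<noteq> 0" using conv_nonzeroD by blast
    then show "m \<in> (\<lambda>(k, l). k + l) ` ({k. s k \<noteq> 0} \<times> {k. t k \<noteq> 0})"
      by (auto intro!: image_eqI[of _ _ "(k, m - k)"])
  qed
  show "finite ((\<lambda>(k, l). k + l) ` ({k. s k \<noteq> 0} \<times> {k. t k \<noteq> 0}))"
    using assms by simp
qed

section \<open>Trigonometric polynomials, decay of convolution powers, deconvolution\<close>

lemma continuous_fourier_finite_support:
  assumes "finite {k. s k \<noteq> 0}"
  shows "continuous_on A (fourier s)"
proof -
  have "fourier s = (\<lambda>\<eta>. \<Sum>k | s k \<noteq> 0. s k * character \<eta> (lattice_point k))"
    using fourier_finite_support[OF assms] by auto
  then show ?thesis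
    unfolding character_def by (simp add: continuous_intros)
qed

lemma lattice_translate_in_unit_cube:
  fixes \<eta> :: "real ^ 'n"
  obtains k where "\<eta> - lattice_point k \<in> cbox 0 1"
proof
  show "\<eta> - lattice_point (\<chi> i. \<lfloor>\<eta> $ i\<rfloor>) \<in> cbox 0 1"
    by (auto simp: mem_box_cart lattice_point_def) linarith
qed

text \<open>Polynomial growth of the number of lattice points in a cube; it limits the support of a
  convolution power.\<close>

lemma finite_int_box: "finite {k::int ^ 'n. \<forall>i. \<bar>k $ i\<bar> \<le> R}"
  and card_int_box_le: "card {k::int ^ 'n. \<forall>i. \<bar>k $ i\<bar> \<le> int r} \<le> (2 * r + 1) ^ CARD('n)"
proof -
  have sub: "{k::int ^ 'n. \<forall>i. \<bar>k $ i\<bar> \<le> R} \<subseteq> vec_lambda ` (PiE UNIV (\<lambda>_. {-R..R}))" for R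
  proof
    fix k :: "int ^ 'n" assume "k \<in> {k. \<forall>i. \<bar>k $ i\<bar> \<le> R}"
    then have "($) k \<in> PiE UNIV (\<lambda>_. {-R..R})" by (auto simp: abs_le_iff minus_le_iff)
    then show "k \<in> vec_lambda ` (PiE UNIV (\<lambda>_. {-R..R}))"
      by (metis image_eqI vec_nth_inverse)
  qed
  have fin: "finite (PiE (UNIV :: 'n set) (\<lambda>_. {-R..R}))" for R :: int
    by (rule finite_PiE) auto
  show "finite {k::int ^ 'n. \<forall>i. \<bar>k $ i\<bar> \<le> R}"
    by (rule finite_subset[OF sub]) (simp add: fin)
  have "card {k::int ^ 'n. \<forall>i. \<bar>k $ i\<bar> \<le> int r}
      \<le> card (vec_lambda ` (PiE (UNIV :: 'n set) (\<lambda>_. {-int r..int r})))"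
    by (rule card_mono[OF _ sub]) (simp add: fin)
  also have "\<dots> \<le> card (PiE (UNIV :: 'n set) (\<lambda>_. {-int r..int r}))"
    by (rule card_image_le[OF fin])
  also have "\<dots> = (2 * r + 1) ^ CARD('n)"
    by (simp add: card_PiE nat_add_distrib nat_mult_distrib)
  finally show "card {k::int ^ 'n. \<forall>i. \<bar>k $ i\<bar> \<le> int r} \<le> (2 * r + 1) ^ CARD('n)" .
qed

text \<open>Distributing q over the d factors as \<sigma> with \<open>\<sigma> ^ d = q\<close> makes
  the expression the d-th power of a linear term times \<open>\<sigma> ^ n\<close>, so the case of
  degree one suffices.\<close>

lemma poly_times_geometric_tendsto_0:
  fixes q :: real
  assumes q: "0 \<le> q" "q < 1" and d: "d > 0"
  shows "(\<lambda>n. real ((2 * (n * r) + 1) ^ d) * q ^ n) \<longlonglongrightarrow> 0"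
proof -
  define \<sigma> where "\<sigma> = root d q"
  have \<sigma>: "0 \<le> \<sigma>" "\<sigma> < 1" "\<sigma> ^ d = q"
    unfolding \<sigma>_def using q d by (auto intro: real_root_lt_1_iff[THEN iffD2])
  have "(\<lambda>n. 2 * real r * (real n * \<sigma> ^ n) + \<sigma> ^ n) \<longlonglongrightarrow> 2 * real r * 0 + 0"
    by (intro tendsto_intros powser_times_n_limit_0 LIMSEQ_power_zero) (use \<sigma> in auto)
  then have "(\<lambda>n. (2 * real r * (real n * \<sigma> ^ n) + \<sigma> ^ n) ^ d) \<longlonglongrightarrow> 0 ^ d"
    by (intro tendsto_power) simp
  moreover have "(2 * real r * (real n * \<sigma> ^ n) + \<sigma> ^ n) ^ d = real ((2 * (n * r) + 1) ^ d) * q ^ n" for n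
  proof -
    have "2 * real r * (real n * \<sigma> ^ n) + \<sigma> ^ n = real (2 * (n * r) + 1) * \<sigma> ^ n"
      by (simp add: algebra_simps)
    then show ?thesis
      by (simp add: power_mult_distrib flip: \<sigma>(3) power_mult) (simp add: mult.commute)
  qed
  ultimately show ?thesis using d by (simp add: zero_power)
qed

abbreviation conv_power :: "(int ^ 'n \<Rightarrow> complex) \<Rightarrow> nat \<Rightarrow> int ^ 'n \<Rightarrow> complex" where
  "conv_power h n \<equiv> (conv h ^^ n) unit_seq"

lemma conv_power_ell: "0 < p \<Longrightarrow> p \<le> 1 \<Longrightarrow> h \<in> ell p \<Longrightarrow> conv_power h n \<in> ell p"
  by (induction n) (auto intro: unit_seq_ell conv_ell)

lemma fourier_conv_power: "h \<in> ell 1 \<Longrightarrow> fourier (conv_power h n) \<eta> = fourier h \<eta> ^ n"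
  by (induction n) (simp_all add: fourier_unit_seq fourier_conv conv_power_ell[of 1])

lemma conv_power_support:
  assumes h: "\<And>k i. h k \<noteq> 0 \<Longrightarrow> \<bar>k $ i\<bar> \<le> R"
  shows "conv_power h n k \<noteq> 0 \<Longrightarrow> \<bar>k $ i\<bar> \<le> int n * R"
proof (induction n arbitrary: k)
  case 0
  then show ?case by (simp add: unit_seq_def split: if_splits)
next
  case (Suc n)
  from Suc.prems obtain l where l: "h l \<noteq> 0" "conv_power h n (k - l) \<noteq> 0"
    using conv_nonzeroD[of h "conv_power h n" k] by auto
  then show ?case using h[of l i] Suc.IH[of "k - l"] by (simp add: algebra_simps)
qed

text \<open>The coefficients of \<open>H\<^sup>n\<close> are at most \<open>\<rho>\<^sup>n\<close>, and only polynomially many of them are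
  nonzero.\<close>

lemma conv_power_mass_tendsto_0:
  fixes h :: "int ^ 'n \<Rightarrow> complex"
  assumes p: "0 < p" and h: "finite {k. h k \<noteq> 0}"
    and \<rho>: "\<And>\<eta>. norm (fourier h \<eta>) \<le> \<rho>" "\<rho> < 1"
  shows "(\<lambda>n. ell_mass p (conv_power h n)) \<longlonglongrightarrow> 0"
proof -
  have \<rho>0: "0 \<le> \<rho>" using \<rho>(1)[of 0] norm_ge_zero order_trans by blast
  \<comment> \<open>A crude bound for all coordinates of all points in the support of h; the n-th
    convolution power then lives in the cube of radius n r.\<close>
  define r where "r = nat (\<Sum>k | h k \<noteq> 0. \<Sum>i\<in>UNIV. \<bar>k $ i\<bar>)"
  have r: "\<bar>k $ i\<bar> \<le> int r" if "h k \<noteq> 0" for k i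
  proof -
    have "\<bar>k $ i\<bar> \<le> (\<Sum>i\<in>UNIV. \<bar>k $ i\<bar>)"
      by (rule member_le_sum) auto
    also have "\<dots> \<le> (\<Sum>k | h k \<noteq> 0. \<Sum>i\<in>UNIV. \<bar>k $ i\<bar>)"
      by (rule member_le_sum) (use h that in \<open>auto intro: sum_nonneg\<close>)
    finally show ?thesis using abs_ge_zero[of "k $ i"] unfolding r_def by linarith
  qed
  have h1: "h \<in> ell 1" by (rule finite_support_in_ell[OF h])
  have le: "ell_mass p (conv_power h n) \<le> real ((2 * (n * r) + 1) ^ CARD('n)) * (\<rho> powr p) ^ n" for n
  proof -
    let ?K = "{k::int ^ 'n. \<forall>i. \<bar>k $ i\<bar> \<le> int (n * r)}"
    have "norm (conv_power h n k) \<le> \<rho> ^ n" for k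
    proof (rule norm_coefficient_le_fourier)
      show "norm (fourier (conv_power h n) \<eta>) \<le> \<rho> ^ n" for \<eta>
        by (simp add: fourier_conv_power[OF h1] norm_power power_mono \<rho>)
    qed (use conv_power_ell[of 1] h1 in simp)
    then have c: "norm (conv_power h n k) powr p \<le> (\<rho> powr p) ^ n" for k
    proof -
      have "(\<rho> ^ n) powr p = (\<rho> powr p) ^ n"
        by (induction n) (simp_all add: powr_mult \<rho>0)
      then show ?thesis using powr_mono2[of p "norm (conv_power h n k)" "\<rho> ^ n"] p \<open>norm (conv_power h n k) \<le> \<rho> ^ n\<close> by simp
    qed
    have "ell_mass p (conv_power h n) = (\<Sum>k\<in>?K. norm (conv_power h n k) powr p)"
      by (rule ell_mass_finite_support[OF finite_int_box])
         (use conv_power_support[of h "int r" n] r in auto)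
    also have "\<dots> \<le> real (card ?K) * (\<rho> powr p) ^ n"
      using sum_mono[of ?K, OF c] by simp
    also have "\<dots> \<le> real ((2 * (n * r) + 1) ^ CARD('n)) * (\<rho> powr p) ^ n"
      using card_int_box_le[where 'n = 'n, of "n * r"]
      by (intro mult_right_mono) (auto simp del: of_nat_power)
    finally show ?thesis .
  qed
  have "\<rho> powr p < 1"
    using powr_less_mono2[of p \<rho> 1] p \<rho> \<rho>0 by simp
  then have lim: "(\<lambda>n. real ((2 * (n * r) + 1) ^ CARD('n)) * (\<rho> powr p) ^ n) \<longlonglongrightarrow> 0"
    by (intro poly_times_geometric_tendsto_0) auto
  show ?thesis
  proof (rule tendsto_sandwich[OF _ _ tendsto_const lim])
    show "\<forall>\<^sub>F n in sequentially. 0 \<le> ell_mass p (conv_power h n)"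
      by (intro always_eventually allI ell_mass_nonneg)
    show "\<forall>\<^sub>F n in sequentially. ell_mass p (conv_power h n)
        \<le> real ((2 * (n * r) + 1) ^ CARD('n)) * (\<rho> powr p) ^ n"
      by (intro always_eventually allI le)
  qed
qed

text \<open>With \<open>G = \<Sum>\<^sub>y |F\<^sub>y|\<^sup>2\<close>, where \<open>F\<^sub>y\<close> is the Fourier series of \<open>f\<^sub>y\<close>, and \<open>H = 1 - G / M\<close>, the identity
  \<open>1 = H\<^sup>N + \<Sum>\<^sub>n\<^sub><\<^sub>N H\<^sup>n G / M\<close> recovers \<open>s\<close> from the convolutions \<open>f\<^sub>y * s\<close> up to the
  small remainder \<open>H\<^sup>N\<close>; no series for \<open>1 / G\<close> is needed.\<close>

lemma deconvolution:
  fixes f :: "'y \<Rightarrow> int ^ 'n \<Rightarrow> complex"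
  assumes p: "0 < p" "p \<le> 1" and Y: "finite Y"
    and f: "\<And>y. y \<in> Y \<Longrightarrow> finite {k. f y k \<noteq> 0}"
    and nz: "\<And>\<eta>. \<eta> \<in> cbox 0 1 \<Longrightarrow> \<exists>y\<in>Y. fourier (f y) \<eta> \<noteq> 0"
  shows "\<exists>C>0. \<forall>s\<in>ell p. ell_mass p s \<le> C * (\<Sum>y\<in>Y. ell_mass p (conv (f y) s))"
proof -
  define G where "G \<eta> = (\<Sum>y\<in>Y. (norm (fourier (f y) \<eta>))\<^sup>2)" for \<eta>
  have Gcont: "continuous_on (cbox 0 1) G"
    unfolding G_def by (intro continuous_intros continuous_fourier_finite_support f)
  have ne: "cbox (0::real ^ 'n) 1 \<noteq> {}" by (auto simp: interval_ne_empty_cart)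
  obtain \<eta>0 where \<eta>0: "\<eta>0 \<in> cbox 0 1" "\<And>\<eta>. \<eta> \<in> cbox 0 1 \<Longrightarrow> G \<eta>0 \<le> G \<eta>"
    using continuous_attains_inf[OF compact_cbox ne Gcont] by blast
  obtain \<eta>1 where \<eta>1: "\<eta>1 \<in> cbox 0 1" "\<And>\<eta>. \<eta> \<in> cbox 0 1 \<Longrightarrow> G \<eta> \<le> G \<eta>1"
    using continuous_attains_sup[OF compact_cbox ne Gcont] by blast
  define M where "M = G \<eta>1"
  have G0: "0 < G \<eta>0"
  proof -
    obtain y where "y \<in> Y" "fourier (f y) \<eta>0 \<noteq> 0" using nz \<eta>0(1) by blast
    then show ?thesis unfolding G_def by (intro sum_pos2[OF Y]) auto
  qed
  \<comment> \<open>Lattice periodicity carries the extrema on the unit cube to the whole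
    space.\<close>
  have Gbd: "G \<eta>0 \<le> G \<eta>" "G \<eta> \<le> M" for \<eta>
  proof -
    obtain k where k: "\<eta> - lattice_point k \<in> cbox 0 1" by (rule lattice_translate_in_unit_cube)
    have "G (\<eta> - lattice_point k) = G \<eta>"
      unfolding G_def using fourier_periodic[of _ "\<eta> - lattice_point k" k] by simp
    with \<eta>0(2)[OF k] \<eta>1(2)[OF k] show "G \<eta>0 \<le> G \<eta>" "G \<eta> \<le> M" by (simp_all add: M_def)
  qed
  have M0: "0 < M" using G0 Gbd(2)[of \<eta>0] by linarith
  \<comment> \<open>Convolving \<open>f' y\<close> with \<open>f y\<close> yields the Fourier series
    |F|^2, so g below has the Fourier series G.\<close>
  define f' where "f' y = (\<lambda>k. cnj (f y (- k)))" for y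
  have f'_fin: "finite {k. f' y k \<noteq> 0}" if "y \<in> Y" for y
  proof -
    have "{k. f' y k \<noteq> 0} = uminus ` {k. f y k \<noteq> 0}"
      by (force simp: f'_def image_iff intro: minus_minus[symmetric])
    then show ?thesis using f[OF that] by simp
  qed
  define g where "g k = (\<Sum>y\<in>Y. conv (f' y) (f y) k)" for k
  have fin: "f y \<in> ell q" "f' y \<in> ell q" if "y \<in> Y" for y q
    using finite_support_in_ell f f'_fin that by blast+
  have g_fin: "finite {k. g k \<noteq> 0}"
  proof (rule finite_subset)
    show "{k. g k \<noteq> 0} \<subseteq> (\<Union>y\<in>Y. {k. conv (f' y) (f y) k \<noteq> 0})"
      unfolding g_def using sum.not_neutral_contains_not_neutral by fastforce
    show "finite (\<Union>y\<in>Y. {k. conv (f' y) (f y) k \<noteq> 0})"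
      using Y f f'_fin by (auto intro!: conv_finite_support)
  qed
  have Fg: "fourier g \<eta> = of_real (G \<eta>)" for \<eta>
  proof -
    have "fourier g \<eta> = (\<Sum>y\<in>Y. fourier (conv (f' y) (f y)) \<eta>)"
      unfolding g_def by (rule fourier_sum) (auto intro!: conv_ell fin)
    also have "\<dots> = (\<Sum>y\<in>Y. of_real ((norm (fourier (f y) \<eta>))\<^sup>2))"
    proof (rule sum.cong[OF refl])
      fix y assume "y \<in> Y"
      then show "fourier (conv (f' y) (f y)) \<eta> = of_real ((norm (fourier (f y) \<eta>))\<^sup>2)"
        using fourier_reflect_cnj[of "f y" \<eta>, folded f'_def]
        by (simp add: fourier_conv fin complex_norm_square mult.commute del: of_real_power)
    qed
    finally show ?thesis by (simp add: G_def)
  qed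
  \<comment> \<open>With M the maximum of G, the Fourier series 1 - G/M lies between 0 and 1 -
    G(\<eta>0)/M, which is below 1 because the minimum G(\<eta>0) is positive.\<close>
  define h where "h k = unit_seq k - of_real (1 / M) * g k" for k
  have h_fin: "finite {k. h k \<noteq> 0}"
  proof (rule finite_subset)
    show "{k. h k \<noteq> 0} \<subseteq> {0} \<union> {k. g k \<noteq> 0}" by (auto simp: h_def unit_seq_def)
  qed (use g_fin in simp)
  have h_ell: "h \<in> ell q" for q by (rule finite_support_in_ell[OF h_fin])
  have g_ell: "g \<in> ell q" for q by (rule finite_support_in_ell[OF g_fin])
  have Fh: "fourier h \<eta> = of_real (1 - G \<eta> / M)" for \<eta>
    unfolding h_def using fourier_diff[of unit_seq "\<lambda>k. of_real (1 / M) * g k" \<eta>]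
    by (simp only: unit_seq_ell ell_cmult(1)[OF g_ell] fourier_unit_seq fourier_cmult Fg) simp
  have "norm (fourier h \<eta>) \<le> 1 - G \<eta>0 / M" for \<eta>
    using Gbd[of \<eta>] M0 unfolding Fh norm_of_real by (auto simp: abs_le_iff divide_right_mono field_simps)
  moreover have "1 - G \<eta>0 / M < 1" using G0 M0 by simp
  ultimately have "(\<lambda>n. ell_mass p (conv_power h n)) \<longlonglongrightarrow> 0"
    by (rule conv_power_mass_tendsto_0[OF p(1) h_fin])
  then have "\<forall>\<^sub>F n in sequentially. ell_mass p (conv_power h n) < 1 / 2"
    by (rule order_tendstoD) simp
  \<comment> \<open>With mass at most 1/2, the remainder costs at most half of
    \<open>ell_mass p s\<close> and can be moved to the left-hand side.\<close>
  then obtain N where N: "ell_mass p (conv_power h N) \<le> 1 / 2"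
    by (auto simp: eventually_sequentially intro: less_imp_le)
  \<comment> \<open>Collects the masses of the finitely many kernels that are convolved with the
    given data \<open>conv (f y) s\<close>; it depends on f and p but not on s.\<close>
  define D where "D = (\<Sum>n<N. \<Sum>y\<in>Y. norm (of_real (1 / M) :: complex) powr p * (ell_mass p (conv_power h n) * ell_mass p (f' y)))"
  have D0: "0 \<le> D"
    unfolding D_def by (intro sum_nonneg mult_nonneg_nonneg ell_mass_nonneg) auto
  have "ell_mass p s \<le> (2 * D + 1) * (\<Sum>y\<in>Y. ell_mass p (conv (f y) s))" if s: "s \<in> ell p" for s
  proof -
    define u where "u n y = conv (conv_power h n) (conv (f' y) (conv (f y) s))" for n y
    have u: "u n y \<in> ell p" if "y \<in> Y" for n y
      unfolding u_def using that by (intro conv_ell p conv_power_ell h_ell fin s)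
    have s1: "s \<in> ell 1" by (rule ell_subset_ell_1[OF p s])
    have u1: "u n y \<in> ell 1" if "y \<in> Y" for n y by (rule ell_subset_ell_1[OF p u[OF that]])
    define v where "v k = (\<Sum>n<N. \<Sum>y\<in>Y. of_real (1 / M) * u n y k)" for k
    have v: "v \<in> ell p"
      unfolding v_def by (intro ell_sum p ell_cmult u)
    have v1: "v \<in> ell 1" by (rule ell_subset_ell_1[OF p v])
    have Fu: "fourier (u n y) \<eta> = fourier h \<eta> ^ n * (of_real ((norm (fourier (f y) \<eta>))\<^sup>2) * fourier s \<eta>)"
      if "y \<in> Y" for n y \<eta>
      using that fourier_reflect_cnj[of "f y" \<eta>, folded f'_def] unfolding u_def
      by (simp add: fourier_conv conv_ell conv_power_ell fin s1 h_ell fourier_conv_power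
           complex_norm_square mult_ac del: of_real_power)
    have Fv: "fourier v \<eta> = (1 - fourier h \<eta> ^ N) * fourier s \<eta>" for \<eta>
    proof -
      have "fourier v \<eta> = (\<Sum>n<N. fourier (\<lambda>k. \<Sum>y\<in>Y. of_real (1 / M) * u n y k) \<eta>)"
        unfolding v_def by (rule fourier_sum, intro ell_sum ell_cmult u1) auto
      also have "\<dots> = (\<Sum>n<N. \<Sum>y\<in>Y. of_real (1 / M) * fourier (u n y) \<eta>)"
        by (intro sum.cong refl) (subst fourier_sum, intro ell_cmult u1, simp_all only: fourier_cmult)
      also have "\<dots> = (\<Sum>n<N. fourier h \<eta> ^ n) * (of_real (1 / M) * of_real (G \<eta>) * fourier s \<eta>)"
      proof -
        have "(\<Sum>y\<in>Y. of_real (1 / M) * fourier (u n y) \<eta>)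
            = fourier h \<eta> ^ n * (of_real (1 / M) * of_real (G \<eta>) * fourier s \<eta>)" for n
          unfolding G_def of_real_sum sum_distrib_left sum_distrib_right
          by (intro sum.cong refl) (simp add: Fu mult_ac)
        then show ?thesis by (simp only: sum_distrib_right)
      qed
      \<comment> \<open>Replacing G/M by 1 - H makes the geometric sum telescope to 1 - H^N.\<close>
      also have "of_real (1 / M) * of_real (G \<eta>) = 1 - fourier h \<eta>"
        by (simp add: Fh)
      also have "(\<Sum>n<N. fourier h \<eta> ^ n) * ((1 - fourier h \<eta>) * fourier s \<eta>)
          = (1 - fourier h \<eta> ^ N) * fourier s \<eta>"
        by (simp only: one_diff_power_eq mult_ac)
      finally show ?thesis .
    qed
    have "s = (\<lambda>k. conv (conv_power h N) s k + v k)"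
    proof (rule fourier_inj[OF s1])
      show "(\<lambda>k. conv (conv_power h N) s k + v k) \<in> ell 1"
        by (intro ell_add conv_ell conv_power_ell h_ell s1 v1) auto
      show "fourier s \<eta> = fourier (\<lambda>k. conv (conv_power h N) s k + v k) \<eta>" for \<eta>
        by (simp add: fourier_add fourier_conv conv_ell conv_power_ell h_ell s1 v1 Fv
            fourier_conv_power algebra_simps)
    qed
    then have "ell_mass p s = ell_mass p (\<lambda>k. conv (conv_power h N) s k + v k)" by simp
    also have "\<dots> \<le> ell_mass p (conv (conv_power h N) s) + ell_mass p v"
      by (intro ell_add p conv_ell conv_power_ell h_ell s v)
    also have "ell_mass p (conv (conv_power h N) s) \<le> ell_mass p (conv_power h N) * ell_mass p s"
      by (intro conv_ell p conv_power_ell h_ell s)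
    also have "\<dots> \<le> 1 / 2 * ell_mass p s"
      by (intro mult_right_mono N ell_mass_nonneg)
    also have "ell_mass p v \<le> D * (\<Sum>y\<in>Y. ell_mass p (conv (f y) s))"
    proof -
      have "ell_mass p v \<le> (\<Sum>n<N. ell_mass p (\<lambda>k. \<Sum>y\<in>Y. of_real (1 / M) * u n y k))"
        unfolding v_def by (intro ell_sum p ell_cmult u)
      also have "\<dots> \<le> (\<Sum>n<N. \<Sum>y\<in>Y. ell_mass p (\<lambda>k. of_real (1 / M) * u n y k))"
        by (intro sum_mono ell_sum p ell_cmult u)
      also have "\<dots> \<le> (\<Sum>n<N. \<Sum>y\<in>Y. (norm (of_real (1 / M) :: complex) powr p * (ell_mass p (conv_power h n) * ell_mass p (f' y)))
          * (\<Sum>y\<in>Y. ell_mass p (conv (f y) s)))"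
      proof (intro sum_mono)
        fix n y assume y: "y \<in> Y"
        have "ell_mass p (u n y) \<le> ell_mass p (conv_power h n) * ell_mass p (conv (f' y) (conv (f y) s))"
          unfolding u_def using y by (intro conv_ell p conv_power_ell h_ell fin s)
        also have "\<dots> \<le> ell_mass p (conv_power h n) * (ell_mass p (f' y) * ell_mass p (conv (f y) s))"
          using y by (intro mult_left_mono conv_ell p fin s ell_mass_nonneg)
        also have "\<dots> \<le> ell_mass p (conv_power h n) * (ell_mass p (f' y) * (\<Sum>y\<in>Y. ell_mass p (conv (f y) s)))"
          using y Y by (intro mult_left_mono ell_mass_nonneg member_le_sum) auto
        finally show "ell_mass p (\<lambda>k. of_real (1 / M) * u n y k)
          \<le> (norm (of_real (1 / M) :: complex) powr p * (ell_mass p (conv_power h n) * ell_mass p (f' y)))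
             * (\<Sum>y\<in>Y. ell_mass p (conv (f y) s))"
          unfolding ell_cmult(2)[OF u[OF y]] mult.assoc by (rule mult_left_mono) simp
      qed
      also have "\<dots> = D * (\<Sum>y\<in>Y. ell_mass p (conv (f y) s))"
        by (simp only: D_def sum_distrib_right)
      finally show ?thesis .
    qed
    \<comment> \<open>Half of \<open>ell_mass p s\<close> has been absorbed, which doubles D. The 1
      added next only guarantees a strictly positive constant.\<close>
    finally have "ell_mass p s \<le> 2 * D * (\<Sum>y\<in>Y. ell_mass p (conv (f y) s))" by simp
    also have "\<dots> \<le> (2 * D + 1) * (\<Sum>y\<in>Y. ell_mass p (conv (f y) s))"
      by (intro mult_right_mono sum_nonneg ell_mass_nonneg) auto
    finally show ?thesis .
  qed
  then show ?thesis using D0 by (intro exI[of _ "2 * D + 1"]) auto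
qed

section \<open>Lebesgue measure under affine bijections\<close>

text \<open>The library's \<open>measure_linear_image\<close> needs a well-ordered index type.\<close>

lemma measurable_matrix_image:
  fixes A :: "real ^ 'n ^ 'n"
  assumes "S \<in> lmeasurable"
  shows "(*v) A ` S \<in> lmeasurable \<and> measure lebesgue ((*v) A ` S) = \<bar>det A\<bar> * measure lebesgue S"
  using assms
proof (induction A arbitrary: S rule: induct_matrix_elementary_alt)
  case (1 A B)
  have eq: "(*v) (A ** B) ` S = (*v) A ` ((*v) B ` S)"
    by (simp add: matrix_vector_mult_matrix_matrix_mult_compose image_comp)
  show ?case
    unfolding eq using "1.IH"(1)[of "(*v) B ` S"] "1.IH"(2)[OF "1.prems"]
    by (simp add: det_mul abs_mult)
next
  case (2 A i)
  \<comment> \<open>A zero row makes the map singular, so the image is negligible and both sides of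
    the formula are 0.\<close>
  have "row i A = 0" by (rule 2)
  then have "det A = 0" by (metis det_zero_row(2))
  then have "\<not> inj ((*v) A)"
    using det_nz_iff_inj[of "(*v) A"] by simp
  then have "negligible ((*v) A ` S)"
    by (intro negligible_linear_singular_image) auto
  then show ?case using \<open>det A = 0\<close> by (simp add: negligible_iff_measure)
next
  case (3 A)
  have "(*v) A = (\<lambda>x. \<chi> i. A $ i $ i * x $ i)"
  proof
    fix x
    have "(A *v x) $ i = A $ i $ i * x $ i" for i
    proof -
      have "(\<Sum>j\<in>UNIV. A $ i $ j * x $ j) = (\<Sum>j\<in>UNIV. if j = i then A $ i $ i * x $ i else 0)"
        by (rule sum.cong) (use 3 in auto)
      then show ?thesis by (simp add: matrix_vector_mult_def)
    qed
    then show "A *v x = (\<chi> i. A $ i $ i * x $ i)" by (simp add: vec_eq_iff)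
  qed
  then show ?case
    using measurable_stretch[OF 3(2)] measure_stretch[OF 3(2)] det_diagonal[of A] 3(1)
    by simp
next
  case (4 m n)
  let ?P = "(\<chi> i j. mat 1 $ i $ Transposition.transpose m n j) :: real ^ 'n ^ 'n"
  let ?h = "\<lambda>v::real ^ 'n. \<chi> i. v $ Transposition.transpose m n i"
  have h: "(*v) ?P = ?h"
  proof
    fix v
    have "(?P *v v) $ i = v $ Transposition.transpose m n i" for i
    proof -
      have "(\<Sum>j\<in>UNIV. ?P $ i $ j * v $ j)
          = (\<Sum>j\<in>UNIV. if j = Transposition.transpose m n i then v $ Transposition.transpose m n i else 0)"
        by (rule sum.cong) (auto simp: mat_def transpose_eq_iff)
      then show ?thesis by (simp add: matrix_vector_mult_def)
    qed
    then show "?P *v v = ?h v" by (simp add: vec_eq_iff)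
  qed
  have 1: "\<bar>det ?P\<bar> = 1"
    by (simp add: det_permute_columns permutes_swap_id sign_swap_id abs_mult)
  \<comment> \<open>By \<open>measure_linear_sufficient\<close> only boxes need checking. A
    transposition of coordinates sends a box to a box with permuted side lengths, so the product of
    the lengths is unchanged.\<close>
  have "measure lebesgue (?h ` cbox a b) = 1 * measure lebesgue (cbox a b)" for a b
  proof (cases "cbox a b = {}")
    case False
    have img: "?h ` cbox a b = cbox (?h a) (?h b)"
    proof (intro equalityI subsetI)
      fix x assume "x \<in> cbox (?h a) (?h b)"
      then have "?h x \<in> cbox a b" by (simp add: mem_box_cart) (metis transpose_involutory)
      moreover have "x = ?h (?h x)" by (simp add: vec_eq_iff)
      ultimately show "x \<in> ?h ` cbox a b" by blast
    qed (auto simp: mem_box_cart)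
    have "(\<Prod>i\<in>UNIV. (b - a) $ Transposition.transpose m n i) = (\<Prod>i\<in>UNIV. (b - a) $ i)"
      using prod.permute[OF permutes_swap_id[of m UNIV n], of "\<lambda>i. (b - a) $ i"] by (simp add: o_def)
    moreover have "cbox (?h a) (?h b) \<noteq> {}" using False img by (metis image_is_empty)
    ultimately show ?thesis using False by (simp add: img content_cbox_cart)
  qed simp
  then show ?case
    unfolding h 1 using measure_linear_sufficient[OF _ 4(2), of ?h 1]
    by (simp add: linear_iff vec_eq_iff)
next
  case (5 m n)
  let ?P = "(\<chi> i j. of_bool (i = m \<and> j = n \<or> i = j)) :: real ^ 'n ^ 'n"
  let ?h = "\<lambda>x::real ^ 'n. \<chi> i. if i = m then x $ m + x $ n else x $ i"
  have h: "(*v) ?P = ?h"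
  proof
    fix v
    have "(?P *v v) $ i = (if i = m then v $ m + v $ n else v $ i)" for i
    proof -
      have "(\<Sum>j\<in>UNIV. ?P $ i $ j * v $ j)
          = (\<Sum>j\<in>UNIV. (if j = i then v $ i else 0) + (if j = n then if i = m then v $ n else 0 else 0))"
        by (rule sum.cong) (use 5(1) in auto)
      then show ?thesis by (simp add: matrix_vector_mult_def sum.distrib)
    qed
    then show "?P *v v = ?h v" by (simp add: vec_eq_iff)
  qed
  have lin: "linear ?h" by (simp add: linear_iff vec_eq_iff algebra_simps)
  have "?P = (\<chi> k. if k = m then row m (mat 1) + 1 *s row n (mat 1) else row k (mat 1))"
    using 5(1) by (auto simp: vec_eq_iff row_def mat_def)
  then have 1: "det ?P = 1"
    using det_row_operation[OF 5(1), of "mat 1" 1] by simp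
  have "measure lebesgue (?h ` cbox a b) = 1 * measure lebesgue (cbox a b)" for a b
  proof (cases "cbox a b = {}")
    case False
    \<comment> \<open>\<open>measure_shear_interval\<close> concerns boxes with nonnegative lower
      coordinate n; translating the lower corner to 0 arranges this without changing the
      measure.\<close>
    have ab: "cbox a b = (+) a ` cbox 0 (b - a)"
      using cbox_translation[of a 0 "b - a"] by simp
    have "?h ` cbox a b = (+) (?h a) ` ?h ` cbox 0 (b - a)"
      unfolding ab image_image by (intro image_cong refl linear_add[OF lin])
    then have "measure lebesgue (?h ` cbox a b) = measure lebesgue (?h ` cbox 0 (b - a))"
      by (simp only: measure_translation)
    also have "\<dots> = measure lebesgue (cbox 0 (b - a))"
      using False ab by (intro measure_shear_interval 5(1)) auto
    also have "\<dots> = measure lebesgue (cbox a b)"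
      by (simp only: ab measure_translation)
    finally show ?thesis by simp
  qed simp
  then show ?case
    unfolding h 1 using measure_linear_sufficient[OF lin 5(2), of 1] by simp
qed

section \<open>Change of variables for linear maps and translations\<close>

text \<open>Assumption c says that Lebesgue measure is c times its own image under T, and
  integration against an image measure is composition with T.\<close>

lemma nn_integral_lebesgue_vimage:
  fixes T :: "'a::euclidean_space \<Rightarrow> 'a" and f :: "'a \<Rightarrow> ennreal"
  assumes T: "T \<in> lebesgue \<rightarrow>\<^sub>M lebesgue"
    and c: "\<And>S. S \<in> sets lebesgue \<Longrightarrow> c * emeasure lebesgue (T -` S) = emeasure lebesgue S"
    and f: "f \<in> borel_measurable lebesgue"
  shows "c * (\<integral>\<^sup>+x. f (T x) \<partial>lebesgue) = (\<integral>\<^sup>+x. f x \<partial>lebesgue)"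
proof -
  have "scale_measure c (distr lebesgue lebesgue T) = lebesgue"
    by (rule measure_eqI) (use T c in \<open>auto simp: emeasure_distr\<close>)
  then have "(\<integral>\<^sup>+x. f x \<partial>lebesgue) = (\<integral>\<^sup>+x. f x \<partial>scale_measure c (distr lebesgue lebesgue T))"
    by simp
  also have "\<dots> = c * (\<integral>\<^sup>+x. f (T x) \<partial>lebesgue)"
    using T f by (simp add: nn_integral_scale_measure nn_integral_distr)
  finally show ?thesis ..
qed

lemma matrix_inv_cancel:
  fixes A :: "real ^ 'n ^ 'n"
  assumes "invertible A"
  shows "A *v (matrix_inv A *v x) = x" "matrix_inv A *v (A *v x) = x"
proof -
  have "A ** matrix_inv A = mat 1 \<and> matrix_inv A ** A = mat 1"
    using assms unfolding invertible_def matrix_inv_def by (rule someI_ex)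
  then show "A *v (matrix_inv A *v x) = x" "matrix_inv A *v (A *v x) = x"
    by (simp_all add: matrix_vector_mul_assoc)
qed

lemma matrix_vimage_eq:
  fixes A :: "real ^ 'n ^ 'n"
  assumes "invertible A"
  shows "(*v) A -` S = (*v) (matrix_inv A) ` S"
  using matrix_inv_cancel[OF assms] by (auto simp: image_iff) (metis)

lemma measurable_matrix_lebesgue:
  fixes A :: "real ^ 'n ^ 'n"
  assumes "invertible A"
  shows "(*v) A \<in> lebesgue \<rightarrow>\<^sub>M lebesgue"
proof (rule measurableI)
  fix S :: "(real ^ 'n) set" assume "S \<in> sets lebesgue"
  then have "(*v) (matrix_inv A) ` S \<in> sets lebesgue"
    by (rule differentiable_image_in_sets_lebesgue)
       (auto intro!: linear_imp_differentiable_on)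
  then show "(*v) A -` S \<inter> space lebesgue \<in> sets lebesgue"
    by (simp add: matrix_vimage_eq[OF assms])
qed simp

lemma nn_integral_matrix:
  fixes A :: "real ^ 'n ^ 'n" and f :: "real ^ 'n \<Rightarrow> ennreal"
  assumes A: "invertible A" and f: "f \<in> borel_measurable lebesgue"
  shows "ennreal \<bar>det A\<bar> * (\<integral>\<^sup>+x. f (A *v x) \<partial>lebesgue) = (\<integral>\<^sup>+x. f x \<partial>lebesgue)"
proof (rule nn_integral_lebesgue_vimage[OF measurable_matrix_lebesgue[OF A] _ f])
  fix S :: "(real ^ 'n) set" assume S: "S \<in> sets lebesgue"
  have img: "(*v) A ` ((*v) A -` S) = S"
    using matrix_inv_cancel[OF A] by (auto simp: image_iff) (metis)
  have vm: "(*v) A -` S \<in> sets lebesgue"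
    using measurable_sets[OF measurable_matrix_lebesgue[OF A] S] by simp
  have det: "\<bar>det A\<bar> > 0" using A by (simp add: invertible_det_nz)
  show "ennreal \<bar>det A\<bar> * emeasure lebesgue ((*v) A -` S) = emeasure lebesgue S"
  \<comment> \<open>The determinant formula covers sets of finite measure. Otherwise S has infinite
    measure as well, since the inverse matrix would carry finiteness back, and a positive
    determinant keeps the left-hand side infinite.\<close>
  proof (cases "(*v) A -` S \<in> lmeasurable")
    case True
    from measurable_matrix_image[OF True, of A] have "S \<in> lmeasurable"
      "measure lebesgue S = \<bar>det A\<bar> * measure lebesgue ((*v) A -` S)"
      by (simp_all only: img)
    then show ?thesis using True
      by (simp add: emeasure_eq_measure2 ennreal_mult)
  next
    case False
    have inf: "emeasure lebesgue T = \<infinity>" if "T \<in> sets lebesgue" "T \<notin> lmeasurable" for T :: "(real ^ 'n) set"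
      using that fmeasurableI[of T lebesgue] by (metis infinity_ennreal_def top.not_eq_extremum)
    have "S \<notin> lmeasurable"
      using False measurable_matrix_image[of S "matrix_inv A"] by (auto simp: matrix_vimage_eq[OF A])
    then have "emeasure lebesgue S = \<infinity>" using S by (intro inf)
    moreover have "emeasure lebesgue ((*v) A -` S) = \<infinity>" using False vm by (intro inf)
    ultimately show ?thesis using det by (simp add: ennreal_mult_top)
  qed
qed

lemma AE_matrix:
  fixes A :: "real ^ 'n ^ 'n"
  assumes A: "invertible A" and P: "AE x in lebesgue. P x"
  shows "AE x in lebesgue. P (A *v x)"
proof -
  from P have "negligible {x. \<not> P x}" by (simp add: negligible_iff_null_sets completion.AE_iff_null_sets)
  then have "negligible ((*v) (matrix_inv A) ` {x. \<not> P x})"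
    using measurable_matrix_image[of "{x. \<not> P x}" "matrix_inv A"] by (simp add: negligible_iff_measure)
  moreover have "(*v) (matrix_inv A) ` {x. \<not> P x} = {x. \<not> P (A *v x)}"
    using matrix_vimage_eq[OF A, of "{x. \<not> P x}"] by auto
  ultimately show ?thesis by (simp add: negligible_iff_null_sets completion.AE_iff_null_sets)
qed

lemma translation_vimage_eq: "(\<lambda>x. x + c) -` S = (+) (- c) ` (S :: 'a::ab_group_add set)"
  by (auto simp: image_iff) (metis add.commute add_diff_cancel_right')

lemma measurable_translation_lebesgue:
  "(\<lambda>x::'a::euclidean_space. x + c) \<in> lebesgue \<rightarrow>\<^sub>M lebesgue"
proof (rule measurableI)
  fix S :: "'a set" assume "S \<in> sets lebesgue"
  then show "(\<lambda>x. x + c) -` S \<inter> space lebesgue \<in> sets lebesgue"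
    using lebesgue_sets_translation[of S "- c"] by (simp add: translation_vimage_eq)
qed simp

lemma nn_integral_lebesgue_translation:
  fixes f :: "'a::euclidean_space \<Rightarrow> ennreal"
  assumes f: "f \<in> borel_measurable lebesgue"
  shows "(\<integral>\<^sup>+x. f (x + c) \<partial>lebesgue) = (\<integral>\<^sup>+x. f x \<partial>lebesgue)"
proof -
  have "1 * (\<integral>\<^sup>+x. f (x + c) \<partial>lebesgue) = (\<integral>\<^sup>+x. f x \<partial>lebesgue)"
  proof (rule nn_integral_lebesgue_vimage[OF measurable_translation_lebesgue _ f])
    fix S :: "'a set"
    show "1 * emeasure lebesgue ((\<lambda>x. x + c) -` S) = emeasure lebesgue S"
      using emeasure_lebesgue_affine[of 1 "- c" S] by (simp add: translation_vimage_eq image_def add.commute)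
  qed
  then show ?thesis by simp
qed

lemma AE_translation:
  fixes c :: "'a::euclidean_space"
  assumes P: "AE x in lebesgue. P x"
  shows "AE x in lebesgue. P (x + c)"
proof -
  from P have "negligible {x. \<not> P x}" by (simp add: negligible_iff_null_sets completion.AE_iff_null_sets)
  then have "negligible ((+) (- c) ` {x. \<not> P x})" by (rule negligible_translation)
  moreover have "(+) (- c) ` {x. \<not> P x} = {x. \<not> P (x + c)}"
    using translation_vimage_eq[of c "{x. \<not> P x}"] by auto
  ultimately show ?thesis by (simp add: negligible_iff_null_sets completion.AE_iff_null_sets)
qed

lemma AE_lattice_translates:
  fixes P :: "real ^ 'n \<Rightarrow> bool"
  assumes "AE x in lebesgue. P x"
  shows "AE x in lebesgue. \<forall>k. P (x + lattice_point k)"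
  using AE_translation[OF assms] by (simp add: AE_all_countable)

section \<open>Sums as integrals\<close>

text \<open>The bridge from unordered sums to integrals over counting measure, through which sums
  over the lattice are exchanged with Lebesgue integrals by Tonelli.\<close>

lemma nn_integral_count_space_summable:
  fixes f :: "'k \<Rightarrow> real"
  assumes f: "\<And>k. 0 \<le> f k"
  shows "f summable_on UNIV \<longleftrightarrow> (\<integral>\<^sup>+k. ennreal (f k) \<partial>count_space UNIV) < \<infinity>"
    and "f summable_on UNIV \<Longrightarrow> (\<integral>\<^sup>+k. ennreal (f k) \<partial>count_space UNIV) = ennreal (infsum f UNIV)"
proof -
  have eq: "f summable_on UNIV \<longleftrightarrow> integrable (count_space UNIV) f"
    using abs_summable_equivalent[of f UNIV] f by (simp add: abs_summable_on_def)
  then show "f summable_on UNIV \<longleftrightarrow> (\<integral>\<^sup>+k. ennreal (f k) \<partial>count_space UNIV) < \<infinity>"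
    using f by (simp add: integrable_iff_bounded)
  assume "f summable_on UNIV"
  then have i: "integrable (count_space UNIV) f" using eq by simp
  then have "infsetsum f UNIV = infsum f UNIV"
    by (intro infsetsum_infsum) (simp add: abs_summable_on_def)
  then show "(\<integral>\<^sup>+k. ennreal (f k) \<partial>count_space UNIV) = ennreal (infsum f UNIV)"
    using nn_integral_eq_integral[OF i] f by (simp add: infsetsum_def)
qed

lemma borel_measurable_nn_integral_count_space:
  fixes f :: "'k::countable \<Rightarrow> 'a \<Rightarrow> ennreal"
  assumes [measurable]: "\<And>k. f k \<in> borel_measurable M"
  shows "(\<lambda>x. \<integral>\<^sup>+k. f k x \<partial>count_space UNIV) \<in> borel_measurable M"
proof -
  interpret sigma_finite_measure "count_space (UNIV :: 'k set)"
    by (rule sigma_finite_measure_count_space)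
  have "(\<lambda>z. f (snd z) (fst z)) \<in> borel_measurable (M \<Otimes>\<^sub>M count_space UNIV)"
    by (rule measurable_compose_countable[where f = "\<lambda>k z. f k (fst z)" and g = snd]) auto
  then show ?thesis
    by (intro borel_measurable_nn_integral) (simp add: case_prod_unfold)
qed

lemma nn_integral_ell_mass:
  "s \<in> ell p \<Longrightarrow> (\<integral>\<^sup>+k. ennreal (norm (s k) powr p) \<partial>count_space UNIV) = ennreal (ell_mass p s)"
  unfolding ell_def ell_mass_def by (intro nn_integral_count_space_summable) auto

text \<open>An enumeration of the index set gives an exhausting sequence of finite sets, along which
  the partial sums converge to the unordered sum wherever the family is summable.\<close>

lemma borel_measurable_infsum_AE:
  fixes f :: "'k::countable \<Rightarrow> 'a::euclidean_space \<Rightarrow> complex"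
  assumes f: "\<And>k. f k \<in> borel_measurable lebesgue"
    and s: "AE x in lebesgue. (\<lambda>k. f k x) summable_on UNIV"
  shows "(\<lambda>x. \<Sum>\<^sub>\<infinity>k. f k x) \<in> borel_measurable lebesgue"
proof -
  define F where "F n = {k::'k. to_nat k < n}" for n
  have fin: "finite (F n)" for n
    unfolding F_def using finite_vimageI[of "{..<n}" "to_nat :: 'k \<Rightarrow> nat"] by (simp add: vimage_def)
  have lim: "filterlim F (finite_subsets_at_top UNIV) sequentially"
    unfolding filterlim_finite_subsets_at_top
  proof safe
    fix X :: "'k set" assume X: "finite X"
    have "\<forall>\<^sub>F n in sequentially. \<forall>k\<in>X. to_nat k < n"
      using X by (intro eventually_ball_finite ballI eventually_gt_at_top)
    then show "\<forall>\<^sub>F n in sequentially. finite (F n) \<and> X \<subseteq> F n \<and> F n \<subseteq> UNIV"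
      by eventually_elim (use fin in \<open>auto simp: F_def\<close>)
  qed
  show ?thesis
  proof (rule borel_measurable_AE)
    show "(\<lambda>x. lim (\<lambda>n. \<Sum>k\<in>F n. f k x)) \<in> borel_measurable lebesgue"
      using f by (intro borel_measurable_lim_metric borel_measurable_sum)
    show "AE x in lebesgue. lim (\<lambda>n. \<Sum>k\<in>F n. f k x) = (\<Sum>\<^sub>\<infinity>k. f k x)"
      using s
    proof eventually_elim
      case (elim x)
      have "(\<lambda>n. \<Sum>k\<in>F n. f k x) \<longlonglongrightarrow> (\<Sum>\<^sub>\<infinity>k. f k x)"
        using filterlim_compose[OF infsum_tendsto[OF elim] lim] .
      then show ?case by (rule limI)
    qed
  qed
qed

section \<open>Integer translates of a function\<close>

definition Lp_mass :: "real \<Rightarrow> ('a::euclidean_space \<Rightarrow> complex) \<Rightarrow> real" where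
  "Lp_mass p f = (\<integral>x. norm (f x) powr p \<partial>lebesgue)"

lemma Lp_mass_nonneg: "0 \<le> Lp_mass p f"
  by (simp add: Lp_mass_def)

lemma nn_integral_Lp_mass:
  "f \<in> Lp_fun p \<Longrightarrow> (\<integral>\<^sup>+x. ennreal (norm (f x) powr p) \<partial>lebesgue) = ennreal (Lp_mass p f)"
  by (auto simp: Lp_mass_def Lp_fun_def intro!: nn_integral_eq_integral)

lemma Lp_funI:
  assumes f: "f \<in> borel_measurable lebesgue" and c: "0 \<le> c"
    and le: "(\<integral>\<^sup>+x. ennreal (norm (f x) powr p) \<partial>lebesgue) \<le> ennreal c"
  shows "f \<in> Lp_fun p" and "Lp_mass p f \<le> c"
proof -
  note [measurable] = f
  have "integrable lebesgue (\<lambda>x. norm (f x) powr p)"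
    using le by (auto simp: integrable_iff_bounded intro: le_less_trans)
  then show "f \<in> Lp_fun p" using f by (simp add: Lp_fun_def)
  then have "ennreal (Lp_mass p f) \<le> ennreal c" using le by (simp add: nn_integral_Lp_mass)
  then show "Lp_mass p f \<le> c" using c by (simp add: ennreal_le_iff)
qed

definition lattice_synthesis :: "(real ^ 'n \<Rightarrow> complex) \<Rightarrow> (int ^ 'n \<Rightarrow> complex) \<Rightarrow> real ^ 'n \<Rightarrow> complex" where
  "lattice_synthesis \<phi> s y = (\<Sum>\<^sub>\<infinity>k. s k * \<phi> (y - lattice_point k))"

definition lattice_sample :: "(real ^ 'n \<Rightarrow> complex) \<Rightarrow> real ^ 'n \<Rightarrow> int ^ 'n \<Rightarrow> complex" where
  "lattice_sample \<phi> y k = \<phi> (y + lattice_point k)"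

lemma lattice_synthesis_translate:
  "lattice_synthesis \<phi> s (y + lattice_point m) = conv s (lattice_sample \<phi> y) m"
  by (simp add: lattice_synthesis_def conv_def lattice_sample_def lattice_point_diff algebra_simps)

lemma measurable_lattice_translate:
  "\<phi> \<in> borel_measurable lebesgue \<Longrightarrow> (\<lambda>y. \<phi> (y + c)) \<in> borel_measurable lebesgue"
  by (rule measurable_compose[OF measurable_translation_lebesgue])

text \<open>By Tonelli and translation invariance, the p-th powers of all terms have total integral
  \<open>ell_mass p s * Lp_mass p \<phi>\<close>. Finiteness gives summability almost everywhere,
  and p-subadditivity at each such y bounds the mass of the sum.\<close>

lemma lattice_synthesis_bound:
  fixes \<phi> :: "real ^ 'n \<Rightarrow> complex"
  assumes p: "0 < p" "p \<le> 1" and \<phi>: "\<phi> \<in> Lp_fun p" and s: "s \<in> ell p"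
  shows "AE y in lebesgue. (\<lambda>k. s k * \<phi> (y - lattice_point k)) summable_on UNIV"
    and "lattice_synthesis \<phi> s \<in> Lp_fun p"
    and "Lp_mass p (lattice_synthesis \<phi> s) \<le> ell_mass p s * Lp_mass p \<phi>"
proof -
  have \<phi>m: "\<phi> \<in> borel_measurable lebesgue" using \<phi> by (simp add: Lp_fun_def)
  have [measurable]: "(\<lambda>y. \<phi> (y - lattice_point k)) \<in> borel_measurable lebesgue" for k
    using measurable_lattice_translate[OF \<phi>m, of "- lattice_point k"] by simp
  let ?t = "\<lambda>k y. norm (s k * \<phi> (y - lattice_point k)) powr p"
  have "(\<integral>\<^sup>+y. (\<integral>\<^sup>+k. ennreal (?t k y) \<partial>count_space UNIV) \<partial>lebesgue)
      = (\<integral>\<^sup>+k. (\<integral>\<^sup>+y. ennreal (?t k y) \<partial>lebesgue) \<partial>count_space UNIV)"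
    by (rule nn_integral_count_space_nn_integral) auto
  also have "\<dots> = (\<integral>\<^sup>+k. ennreal (norm (s k) powr p) * ennreal (Lp_mass p \<phi>) \<partial>count_space UNIV)"
  proof (rule nn_integral_cong)
    fix k
    have "(\<integral>\<^sup>+y. ennreal (?t k y) \<partial>lebesgue)
        = (\<integral>\<^sup>+y. ennreal (norm (s k) powr p) * ennreal (norm (\<phi> (y - lattice_point k)) powr p) \<partial>lebesgue)"
      by (simp add: norm_mult powr_mult ennreal_mult')
    also have "\<dots> = ennreal (norm (s k) powr p) * (\<integral>\<^sup>+y. ennreal (norm (\<phi> (y - lattice_point k)) powr p) \<partial>lebesgue)"
      by (rule nn_integral_cmult) auto
    also have "(\<integral>\<^sup>+y. ennreal (norm (\<phi> (y - lattice_point k)) powr p) \<partial>lebesgue) = ennreal (Lp_mass p \<phi>)"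
      using nn_integral_lebesgue_translation[of "\<lambda>y. ennreal (norm (\<phi> y) powr p)" "- lattice_point k"] \<phi>m
      by (simp add: nn_integral_Lp_mass[OF \<phi>])
    finally show "(\<integral>\<^sup>+y. ennreal (?t k y) \<partial>lebesgue) = ennreal (norm (s k) powr p) * ennreal (Lp_mass p \<phi>)" .
  qed
  also have "\<dots> = ennreal (ell_mass p s * Lp_mass p \<phi>)"
    by (subst nn_integral_multc) (auto simp: nn_integral_ell_mass[OF s] ennreal_mult ell_mass_nonneg Lp_mass_nonneg)
  finally have total: "(\<integral>\<^sup>+y. (\<integral>\<^sup>+k. ennreal (?t k y) \<partial>count_space UNIV) \<partial>lebesgue)
      = ennreal (ell_mass p s * Lp_mass p \<phi>)" .
  have meas: "(\<lambda>y. \<integral>\<^sup>+k. ennreal (?t k y) \<partial>count_space UNIV) \<in> borel_measurable lebesgue"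
    by (intro borel_measurable_nn_integral_count_space) auto
  have "AE y in lebesgue. (\<integral>\<^sup>+k. ennreal (?t k y) \<partial>count_space UNIV) \<noteq> \<infinity>"
    by (rule nn_integral_noteq_infinite[OF meas]) (simp add: total)
  then have sump: "AE y in lebesgue. (\<lambda>k. ?t k y) summable_on UNIV"
  proof eventually_elim
    case (elim y)
    then show ?case using nn_integral_count_space_summable(1)[of "\<lambda>k. ?t k y"] by (simp add: less_top)
  qed
  then show sum: "AE y in lebesgue. (\<lambda>k. s k * \<phi> (y - lattice_point k)) summable_on UNIV"
    by eventually_elim (rule abs_summable_summable, rule infsum_norm_powr_le(1)[OF p])
  have m: "lattice_synthesis \<phi> s \<in> borel_measurable lebesgue"
    unfolding lattice_synthesis_def[abs_def] by (rule borel_measurable_infsum_AE[OF _ sum]) simp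
  have "(\<integral>\<^sup>+y. ennreal (norm (lattice_synthesis \<phi> s y) powr p) \<partial>lebesgue)
      \<le> (\<integral>\<^sup>+y. (\<integral>\<^sup>+k. ennreal (?t k y) \<partial>count_space UNIV) \<partial>lebesgue)"
  proof (rule nn_integral_mono_AE)
    show "AE y in lebesgue. ennreal (norm (lattice_synthesis \<phi> s y) powr p) \<le> (\<integral>\<^sup>+k. ennreal (?t k y) \<partial>count_space UNIV)"
      using sump
    proof eventually_elim
      case (elim y)
      then show ?case using infsum_norm_powr_le(2)[OF p elim]
        by (simp add: nn_integral_count_space_summable(2) lattice_synthesis_def ennreal_leI)
    qed
  qed
  then have le: "(\<integral>\<^sup>+y. ennreal (norm (lattice_synthesis \<phi> s y) powr p) \<partial>lebesgue)
      \<le> ennreal (ell_mass p s * Lp_mass p \<phi>)"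
    by (simp only: total)
  have nn: "0 \<le> ell_mass p s * Lp_mass p \<phi>" by (simp add: ell_mass_nonneg Lp_mass_nonneg)
  show "lattice_synthesis \<phi> s \<in> Lp_fun p" "Lp_mass p (lattice_synthesis \<phi> s) \<le> ell_mass p s * Lp_mass p \<phi>"
    by (fact Lp_funI[OF m nn le])+
qed

lemma lattice_synthesis_diff:
  assumes p: "0 < p" "p \<le> 1" and \<phi>: "\<phi> \<in> Lp_fun p" and s: "s \<in> ell p" and t: "t \<in> ell p"
  shows "AE y in lebesgue. lattice_synthesis \<phi> (\<lambda>k. s k - t k) y
    = lattice_synthesis \<phi> s y - lattice_synthesis \<phi> t y"
  using lattice_synthesis_bound(1)[OF p \<phi> s] lattice_synthesis_bound(1)[OF p \<phi> t]
proof eventually_elim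
  case (elim y)
  then have "lattice_synthesis \<phi> s y - lattice_synthesis \<phi> t y
    = (\<Sum>\<^sub>\<infinity>k. s k * \<phi> (y - lattice_point k) + - (t k * \<phi> (y - lattice_point k)))"
    unfolding lattice_synthesis_def by (subst infsum_add) (auto simp: infsum_uminus summable_on_uminus)
  then show ?case by (simp add: lattice_synthesis_def left_diff_distrib)
qed

section \<open>Injectivity\<close>

text \<open>If \<open>\<Sum>\<^sub>k s\<^sub>k \<phi>(y + m - k) = 0\<close> for all \<open>m\<close>, then \<open>s\<close> is annihilated by convolution with the
  sample \<open>\<phi>(y + \<sqdot>)\<close>. Absolute summability of the sample comes for free: a nonzero \<open>infsum\<close>
  is the sum of a summable family.\<close>

lemma lattice_synthesis_zero_imp:
  fixes \<phi> :: "real ^ 'n \<Rightarrow> complex"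
  assumes nz: "\<And>\<eta>. \<not> (AE y in lebesgue. fourier (lattice_sample \<phi> y) \<eta> = 0)"
    and s: "s \<in> ell 1" and zero: "AE y in lebesgue. lattice_synthesis \<phi> s y = 0"
  shows "s = (\<lambda>_. 0)"
proof (rule fourier_inj[OF s])
  show "(\<lambda>_. 0) \<in> ell 1" by (rule ell_zero)
  fix \<eta>
  \<comment> \<open>A set of full measure, where the synthesis vanishes on the whole orbit, must
    meet the non-null set where the sample has nonzero Fourier series. The point y found here
    depends on \<eta>, which is harmless since uniqueness is tested one frequency at a time.\<close>
  have "\<exists>y. (\<forall>m. lattice_synthesis \<phi> s (y + lattice_point m) = 0) \<and> fourier (lattice_sample \<phi> y) \<eta> \<noteq> 0"
  proof (rule ccontr)
    assume "\<not> ?thesis"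
    then have "fourier (lattice_sample \<phi> y) \<eta> = 0"
      if "\<forall>m. lattice_synthesis \<phi> s (y + lattice_point m) = 0" for y
      using that by blast
    with AE_lattice_translates[OF zero] have "AE y in lebesgue. fourier (lattice_sample \<phi> y) \<eta> = 0"
      by (rule eventually_mono)
    with nz show False by blast
  qed
  then obtain y where y: "\<And>m. lattice_synthesis \<phi> s (y + lattice_point m) = 0"
    and F: "fourier (lattice_sample \<phi> y) \<eta> \<noteq> 0" by blast
  have "(\<lambda>k. lattice_sample \<phi> y k * character \<eta> (lattice_point k)) summable_on UNIV"
    using F unfolding fourier_def by (metis infsum_not_exists)
  then have "lattice_sample \<phi> y \<in> ell 1"
    by (simp add: summable_on_iff_abs_summable_on_complex norm_mult ell_1_iff)
  then have "fourier (conv s (lattice_sample \<phi> y)) \<eta> = fourier s \<eta> * fourier (lattice_sample \<phi> y) \<eta>"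
    by (rule fourier_conv[OF s])
  moreover have "conv s (lattice_sample \<phi> y) = (\<lambda>_. 0)"
    using y by (simp add: lattice_synthesis_translate fun_eq_iff)
  ultimately show "fourier s \<eta> = fourier (\<lambda>_. 0) \<eta>" using F by (simp add: fourier_def)
qed

section \<open>The lower bound for compactly supported generators\<close>

text \<open>The exceptional points are those mapped into an open set with negligible preimage. By
  Lindelof, countably many such open sets have the same union, so the exceptional set is a countable
  union of negligible sets.\<close>

lemma AE_essential_value:
  fixes \<Phi> :: "'a::euclidean_space \<Rightarrow> 'b::second_countable_topology"
  shows "AE x in lebesgue. \<forall>U. open U \<longrightarrow> \<Phi> x \<in> U \<longrightarrow> \<not> negligible {y. \<Phi> y \<in> U}"
proof -
  define \<U> where "\<U> = {U. open U \<and> negligible {y. \<Phi> y \<in> U}}"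
  obtain \<V> where \<V>: "\<V> \<subseteq> \<U>" "countable \<V>" "\<Union>\<V> = \<Union>\<U>"
    by (rule Lindelof[of \<U>]) (auto simp: \<U>_def)
  have "negligible (\<Union>U\<in>\<V>. {y. \<Phi> y \<in> U})"
    by (rule negligible_countable_Union) (use \<V> in \<open>auto simp: \<U>_def\<close>)
  moreover have "(\<Union>U\<in>\<V>. {y. \<Phi> y \<in> U}) = {x. \<Phi> x \<in> \<Union>\<U>}" using \<V>(3) by auto
  moreover have "{x. \<Phi> x \<in> \<Union>\<U>} = {x. \<not> (\<forall>U. open U \<longrightarrow> \<Phi> x \<in> U \<longrightarrow> \<not> negligible {y. \<Phi> y \<in> U})}"
    by (auto simp: \<U>_def)
  ultimately show ?thesis by (simp add: negligible_iff_null_sets completion.AE_iff_null_sets)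
qed

lemma finite_lattice_ball: "finite {k::int ^ 'n. norm (lattice_point k) \<le> R}"
proof (rule finite_subset)
  show "{k::int ^ 'n. norm (lattice_point k) \<le> R} \<subseteq> {k. \<forall>i. \<bar>k $ i\<bar> \<le> \<lceil>R\<rceil>}"
  proof safe
    fix k :: "int ^ 'n" and i assume "norm (lattice_point k) \<le> R"
    moreover have "\<bar>lattice_point k $ i\<bar> \<le> norm (lattice_point k)" by (rule component_le_norm_cart)
    ultimately have "of_int \<bar>k $ i\<bar> \<le> R" by (simp add: lattice_point_def)
    then show "\<bar>k $ i\<bar> \<le> \<lceil>R\<rceil>" by linarith
  qed
qed (rule finite_int_box)

text \<open>Compact support makes the samples at nearby points finitely supported in a common set, so
  closeness in the product topology is closeness in \<open>\<ell>\<^sup>p\<close>.\<close>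

lemma AE_sample_approximation:
  fixes \<phi> :: "real ^ 'n \<Rightarrow> complex"
  assumes p: "0 < p" "p \<le> 1" and \<phi>: "\<phi> \<in> borel_measurable lebesgue" and supp: "compactly_supported \<phi>"
  shows "AE y in lebesgue. finite {k. lattice_sample \<phi> y k \<noteq> 0} \<and>
    (\<forall>\<epsilon>>0. \<exists>E\<in>sets lebesgue. E \<subseteq> ball y (1/2) \<and> \<not> negligible E \<and>
       (AE z in lebesgue. z \<in> E \<longrightarrow> lattice_sample \<phi> z \<in> ell p \<and>
          ell_mass p (\<lambda>k. lattice_sample \<phi> y k - lattice_sample \<phi> z k) \<le> \<epsilon>))"
proof -
  obtain K where K: "compact K" "AE x in lebesgue. x \<notin> K \<longrightarrow> \<phi> x = 0"
    using supp by (auto simp: compactly_supported_def)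
  obtain R where R: "\<And>x. x \<in> K \<Longrightarrow> norm x \<le> R"
    using compact_imp_bounded[OF K(1)] by (auto simp: bounded_iff)
  have AE1: "AE y in lebesgue. \<forall>k. y + lattice_point k \<notin> K \<longrightarrow> \<phi> (y + lattice_point k) = 0"
    by (rule AE_lattice_translates[OF K(2)])
  \<comment> \<open>Pairing the sample with y lets one open neighbourhood enforce both that z is
    near y and that the samples are close.\<close>
  define \<Phi> where "\<Phi> y = (y, lattice_sample \<phi> y)" for y
  show ?thesis
    using AE1 AE_essential_value[of \<Phi>]
  proof eventually_elim
    case (elim y)
    \<comment> \<open>Contains the sample support for every z within 1/2 of y outside a null set:
      the supporting set has radius R, and |z| is at most |y| + 1.\<close>
    define S where "S = {k::int ^ 'n. norm (lattice_point k) \<le> R + norm y + 1}"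
    have S: "finite S" unfolding S_def by (rule finite_lattice_ball)
    have supp_S: "lattice_sample \<phi> z k = 0"
      if z: "z \<in> ball y (1/2)" "\<forall>k. z + lattice_point k \<notin> K \<longrightarrow> \<phi> (z + lattice_point k) = 0" and k: "k \<notin> S" for z k
    proof -
      have "norm (lattice_point k) \<le> norm (z + lattice_point k) + norm z"
        using norm_triangle_ineq4[of "z + lattice_point k" z] by simp
      moreover have "norm z \<le> norm y + 1"
        using z(1) norm_triangle_ineq2[of z y] by (simp add: dist_norm norm_minus_commute)
      ultimately have "z + lattice_point k \<notin> K" using R[of "z + lattice_point k"] k by (auto simp: S_def)
      then show ?thesis using z(2) by (simp add: lattice_sample_def)
    qed
    have yS: "lattice_sample \<phi> y k = 0" if "k \<notin> S" for k
      by (rule supp_S) (use elim that in auto)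
    have "\<exists>E\<in>sets lebesgue. E \<subseteq> ball y (1/2) \<and> \<not> negligible E \<and>
       (AE z in lebesgue. z \<in> E \<longrightarrow> lattice_sample \<phi> z \<in> ell p \<and>
          ell_mass p (\<lambda>k. lattice_sample \<phi> y k - lattice_sample \<phi> z k) \<le> \<epsilon>)" if \<epsilon>: "\<epsilon> > 0" for \<epsilon>
    proof -
      \<comment> \<open>Chosen so that at most \<open>card S\<close> terms of size \<delta>^p add up
        to at most \<epsilon>; the added 1 excludes division by zero.\<close>
      define \<delta> where "\<delta> = (\<epsilon> / (card S + 1)) powr (1 / p)"
      have \<delta>: "\<delta> > 0" "\<delta> powr p = \<epsilon> / (card S + 1)"
        using \<epsilon> p by (simp_all add: \<delta>_def powr_powr)
      \<comment> \<open>Only the finitely many coordinates in S are constrained, so V is open in the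
        product topology.\<close>
      define V where "V = (\<Inter>k\<in>S. (\<lambda>f. f k) -` ball (lattice_sample \<phi> y k) \<delta>)"
      have "open V"
        unfolding V_def using S
        by (intro open_INT ballI open_vimage open_ball continuous_on_product_coordinates)
      then have U: "open (ball y (1/2) \<times> V)" by (intro open_Times open_ball)
      define E where "E = {z. \<Phi> z \<in> ball y (1/2) \<times> V}"
      have "\<Phi> y \<in> ball y (1/2) \<times> V" using \<delta> by (simp add: \<Phi>_def V_def)
      then have nn: "\<not> negligible E" unfolding E_def using elim(2) U by simp
      have "E = ball y (1/2) \<inter> (\<Inter>k\<in>S. {z. lattice_sample \<phi> z k \<in> ball (lattice_sample \<phi> y k) \<delta>})"
        by (auto simp: E_def \<Phi>_def V_def)
      moreover have "{z. lattice_sample \<phi> z k \<in> ball (lattice_sample \<phi> y k) \<delta>} \<in> sets lebesgue" for k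
        using measurable_sets[OF measurable_lattice_translate[OF \<phi>, of "lattice_point k"], of "ball (lattice_sample \<phi> y k) \<delta>"]
        by (simp add: lattice_sample_def vimage_def)
      ultimately have Em: "E \<in> sets lebesgue"
        using S by (cases "S = {}") (auto intro!: sets.Int sets.finite_INT)
      have "AE z in lebesgue. z \<in> E \<longrightarrow> lattice_sample \<phi> z \<in> ell p \<and>
          ell_mass p (\<lambda>k. lattice_sample \<phi> y k - lattice_sample \<phi> z k) \<le> \<epsilon>"
        using AE1
      proof eventually_elim
        case (elim z)
        show ?case
        proof (intro impI conjI)
          assume z: "z \<in> E"
          then have zb: "z \<in> ball y (1/2)" by (simp add: E_def \<Phi>_def)
          have zS: "lattice_sample \<phi> z k = 0" if "k \<notin> S" for k
            by (rule supp_S[OF zb elim that])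
          show "lattice_sample \<phi> z \<in> ell p"
            by (rule finite_support_in_ell, rule finite_subset[OF _ S]) (use zS in auto)
          have "ell_mass p (\<lambda>k. lattice_sample \<phi> y k - lattice_sample \<phi> z k)
              = (\<Sum>k\<in>S. norm (lattice_sample \<phi> y k - lattice_sample \<phi> z k) powr p)"
            by (rule ell_mass_finite_support[OF S]) (simp add: yS zS)
          also have "\<dots> \<le> (\<Sum>k\<in>S. \<delta> powr p)"
          proof (intro sum_mono powr_mono2)
            fix k assume "k \<in> S"
            then show "norm (lattice_sample \<phi> y k - lattice_sample \<phi> z k) \<le> \<delta>"
              using z by (auto simp: E_def \<Phi>_def V_def dist_norm)
          qed (use p in auto)
          also have "\<dots> \<le> \<epsilon>" using \<epsilon> by (simp add: \<delta>(2) field_simps)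
          finally show "ell_mass p (\<lambda>k. lattice_sample \<phi> y k - lattice_sample \<phi> z k) \<le> \<epsilon>" .
        qed
      qed
      moreover have "E \<subseteq> ball y (1/2)" by (auto simp: E_def \<Phi>_def)
      ultimately show ?thesis using Em nn by (intro bexI[of _ E] conjI)
    qed
    moreover have "finite {k. lattice_sample \<phi> y k \<noteq> 0}"
      by (rule finite_subset[OF _ S]) (use yS in auto)
    ultimately show ?case by blast
  qed
qed

text \<open>Distinct lattice points are at distance at least 1, so the translates of a subset of a ball
  of radius \<open>1/2\<close> are disjoint.\<close>

lemma nn_integral_lattice_translates_le:
  fixes g :: "real ^ 'n \<Rightarrow> ennreal"
  assumes g: "g \<in> borel_measurable lebesgue" and E: "E \<in> sets lebesgue" "E \<subseteq> ball y (1/2)"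
  shows "(\<integral>\<^sup>+z. (\<integral>\<^sup>+m. g (z + lattice_point m) \<partial>count_space UNIV) * indicator E z \<partial>lebesgue)
    \<le> (\<integral>\<^sup>+x. g x \<partial>lebesgue)"
proof -
  note [measurable] = g E(1)
  have m1: "(\<lambda>z. g (z + lattice_point m)) \<in> borel_measurable lebesgue" for m
    by (rule measurable_compose[OF measurable_translation_lebesgue g])
  note [measurable] = m1
  have m2: "(\<lambda>x. indicator E (x - lattice_point m) :: ennreal) \<in> borel_measurable lebesgue" for m
    using measurable_compose[OF measurable_translation_lebesgue borel_measurable_indicator[OF E(1)], of "- lattice_point m"]
    by simp
  note [measurable] = m2
  have "(\<integral>\<^sup>+z. (\<integral>\<^sup>+m. g (z + lattice_point m) \<partial>count_space UNIV) * indicator E z \<partial>lebesgue)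
      = (\<integral>\<^sup>+z. (\<integral>\<^sup>+m. g (z + lattice_point m) * indicator E z \<partial>count_space UNIV) \<partial>lebesgue)"
    by (simp add: nn_integral_multc)
  also have "\<dots> = (\<integral>\<^sup>+m. (\<integral>\<^sup>+z. g (z + lattice_point m) * indicator E z \<partial>lebesgue) \<partial>count_space UNIV)"
    by (rule nn_integral_count_space_nn_integral) auto
  also have "\<dots> = (\<integral>\<^sup>+m. (\<integral>\<^sup>+x. g x * indicator E (x - lattice_point m) \<partial>lebesgue) \<partial>count_space UNIV)"
  proof (rule nn_integral_cong)
    fix m
    show "(\<integral>\<^sup>+z. g (z + lattice_point m) * indicator E z \<partial>lebesgue)
        = (\<integral>\<^sup>+x. g x * indicator E (x - lattice_point m) \<partial>lebesgue)"
      using nn_integral_lebesgue_translation[of "\<lambda>x. g x * indicator E (x - lattice_point m)" "lattice_point m"]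
      by simp
  qed
  also have "\<dots> = (\<integral>\<^sup>+x. (\<integral>\<^sup>+m. g x * indicator E (x - lattice_point m) \<partial>count_space UNIV) \<partial>lebesgue)"
    by (rule nn_integral_count_space_nn_integral[symmetric]) auto
  also have "\<dots> \<le> (\<integral>\<^sup>+x. g x \<partial>lebesgue)"
  proof (rule nn_integral_mono)
    fix x
    let ?M = "{m::int ^ 'n. x - lattice_point m \<in> E}"
    have uniq: "m = m'" if "m \<in> ?M" "m' \<in> ?M" for m m'
    proof -
      have "dist (x - lattice_point m) (x - lattice_point m') < 1/2 + 1/2"
        using that E(2) by (intro dist_triangle_less_add[of _ y]) (auto simp: subset_iff dist_commute)
      then have n1: "norm (lattice_point (m' - m)) < 1" by (simp add: dist_norm lattice_point_diff)
      have "(m' - m) $ i = 0" for i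
      proof -
        have "\<bar>lattice_point (m' - m) $ i\<bar> < 1"
          using component_le_norm_cart[of "lattice_point (m' - m)" i] n1 by linarith
        then show ?thesis by (simp add: lattice_point_def)
      qed
      then show ?thesis by (simp add: vec_eq_iff)
    qed
    have "?M = {} \<or> (\<exists>m. ?M = {m})" using uniq by blast
    then have "(\<integral>\<^sup>+m. indicator ?M m \<partial>count_space UNIV) \<le> (1::ennreal)"
      by (auto simp: nn_integral_indicator)
    then have "g x * (\<integral>\<^sup>+m. indicator ?M m \<partial>count_space UNIV) \<le> g x * 1" by (rule mult_left_mono) simp
    moreover have "(\<integral>\<^sup>+m. g x * indicator E (x - lattice_point m) \<partial>count_space UNIV)
        = g x * (\<integral>\<^sup>+m. indicator ?M m \<partial>count_space UNIV)"
      by (subst nn_integral_cmult[symmetric]) (auto simp: indicator_def)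
    ultimately show "(\<integral>\<^sup>+m. g x * indicator E (x - lattice_point m) \<partial>count_space UNIV) \<le> g x" by simp
  qed
  finally show ?thesis .
qed

lemma conv_diff_left:
  fixes f g s :: "int ^ 'n \<Rightarrow> complex"
  assumes "f \<in> ell 1" "g \<in> ell 1" "s \<in> ell 1"
  shows "conv (\<lambda>k. f k - g k) s = (\<lambda>k. conv f s k - conv g s k)"
  by (rule fourier_inj)
     (use assms in \<open>simp_all add: conv_ell ell_diff fourier_conv fourier_diff left_diff_distrib\<close>)

text \<open>For z in E, write the sample at y as the sample at z plus an error of mass at most
  \<epsilon>. Convolving the first with s gives the synthesis on the orbit of z; integrating its
  mass over E stays below the full Lp mass because the translates of E are disjoint.\<close>

lemma sample_estimate:
  fixes \<phi> :: "real ^ 'n \<Rightarrow> complex"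
  assumes p: "0 < p" "p \<le> 1" and \<phi>: "\<phi> \<in> Lp_fun p" and s: "s \<in> ell p"
    and E: "E \<in> sets lebesgue" "E \<subseteq> ball y (1/2)" "\<not> negligible E"
    and y: "finite {k. lattice_sample \<phi> y k \<noteq> 0}"
    and approx: "AE z in lebesgue. z \<in> E \<longrightarrow> lattice_sample \<phi> z \<in> ell p \<and>
          ell_mass p (\<lambda>k. lattice_sample \<phi> y k - lattice_sample \<phi> z k) \<le> \<epsilon>"
    and \<epsilon>: "0 \<le> \<epsilon>"
  shows "ell_mass p (conv (lattice_sample \<phi> y) s)
    \<le> Lp_mass p (lattice_synthesis \<phi> s) / measure lebesgue E + \<epsilon> * ell_mass p s"
proof -
  let ?U = "lattice_synthesis \<phi> s" and ?f = "lattice_sample \<phi>" and ?\<mu> = "measure lebesgue E"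
  let ?a = "ell_mass p (conv (?f y) s)"
  let ?A = "\<lambda>z. \<integral>\<^sup>+m. ennreal (norm (?U (z + lattice_point m)) powr p) \<partial>count_space UNIV"
  let ?e = "ennreal (\<epsilon> * ell_mass p s)"
  have U: "?U \<in> Lp_fun p" by (rule lattice_synthesis_bound(2)[OF p \<phi> s])
  then have Um [measurable]: "?U \<in> borel_measurable lebesgue" by (simp add: Lp_fun_def)
  have [measurable]: "(\<lambda>z. ?U (z + lattice_point m)) \<in> borel_measurable lebesgue" for m
    by (rule measurable_lattice_translate[OF Um])
  note [measurable] = E(1)
  have Am [measurable]: "?A \<in> borel_measurable lebesgue"
    by (rule borel_measurable_nn_integral_count_space) simp
  have Elm: "E \<in> lmeasurable"
    using E(1,2) bounded_subset[OF bounded_ball] by (intro bounded_set_imp_lmeasurable) auto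
  have \<mu>: "0 < ?\<mu>" "emeasure lebesgue E = ennreal ?\<mu>"
    using E(3) Elm negligible_iff_measure[of E] by (auto simp: emeasure_eq_measure2 less_le)
  have fy: "?f y \<in> ell q" for q by (rule finite_support_in_ell[OF y])
  have s1: "s \<in> ell 1" by (rule ell_subset_ell_1[OF p s])
  have "AE z in lebesgue. ennreal ?a * indicator E z \<le> ?A z * indicator E z + ?e * indicator E z"
    using approx
  proof eventually_elim
    case (elim z)
    show ?case
    proof (cases "z \<in> E")
      case True
      with elim have fz: "?f z \<in> ell p" and d: "ell_mass p (\<lambda>k. ?f y k - ?f z k) \<le> \<epsilon>" by auto
      have fz1: "?f z \<in> ell 1" by (rule ell_subset_ell_1[OF p fz])
      have dif: "(\<lambda>k. ?f y k - ?f z k) \<in> ell p" by (rule ell_diff[OF p fy fz])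
      have "conv (?f y) s = (\<lambda>k. conv (?f z) s k + conv (\<lambda>k. ?f y k - ?f z k) s k)"
        by (simp add: conv_diff_left[OF fy fz1 s1])
      then have "?a \<le> ell_mass p (conv (?f z) s) + ell_mass p (conv (\<lambda>k. ?f y k - ?f z k) s)"
        using ell_add(2)[OF p conv_ell(1)[OF p fz s] conv_ell(1)[OF p dif s]] by simp
      also have "ell_mass p (conv (\<lambda>k. ?f y k - ?f z k) s) \<le> ell_mass p (\<lambda>k. ?f y k - ?f z k) * ell_mass p s"
        by (rule conv_ell[OF p dif s])
      also have "\<dots> \<le> \<epsilon> * ell_mass p s"
        by (rule mult_right_mono[OF d ell_mass_nonneg])
      finally have "?a \<le> ell_mass p (conv (?f z) s) + \<epsilon> * ell_mass p s" by simp
      then have "ennreal ?a \<le> ennreal (ell_mass p (conv (?f z) s)) + ?e"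
        using \<epsilon> ell_mass_nonneg by (subst ennreal_plus[symmetric]) (auto intro: ennreal_leI)
      \<comment> \<open>The two factors are commuted because
        \<open>lattice_synthesis_translate\<close> describes the synthesis on an orbit with s as the
        first factor.\<close>
      also have "ennreal (ell_mass p (conv (?f z) s)) = ?A z"
        using nn_integral_ell_mass[OF conv_ell(1)[OF p s fz]]
        by (simp add: lattice_synthesis_translate conv_commute[OF fz1 s1])
      finally show ?thesis using True by simp
    qed simp
  qed
  then have "(\<integral>\<^sup>+z. ennreal ?a * indicator E z \<partial>lebesgue)
      \<le> (\<integral>\<^sup>+z. ?A z * indicator E z + ?e * indicator E z \<partial>lebesgue)"
    by (rule nn_integral_mono_AE)
  also have "\<dots> = (\<integral>\<^sup>+z. ?A z * indicator E z \<partial>lebesgue) + ?e * emeasure lebesgue E"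
    by (subst nn_integral_add) (auto simp: nn_integral_cmult_indicator)
  also have "(\<integral>\<^sup>+z. ?A z * indicator E z \<partial>lebesgue) \<le> ennreal (Lp_mass p ?U)"
    using nn_integral_lattice_translates_le[OF _ E(1,2), of "\<lambda>x. ennreal (norm (?U x) powr p)"]
    by (simp add: nn_integral_Lp_mass[OF U])
  finally have "ennreal ?a * ennreal ?\<mu> \<le> ennreal (Lp_mass p ?U) + ?e * ennreal ?\<mu>"
    using nn_integral_cmult_indicator[OF E(1), of "ennreal ?a"] by (simp add: \<mu>(2) del: emeasure_completion)
  then have "ennreal (?a * ?\<mu>) \<le> ennreal (Lp_mass p ?U + \<epsilon> * ell_mass p s * ?\<mu>)"
    using \<mu>(1) \<epsilon> by (simp add: ennreal_mult ell_mass_nonneg Lp_mass_nonneg ennreal_plus)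
  then have "?a * ?\<mu> \<le> Lp_mass p ?U + \<epsilon> * ell_mass p s * ?\<mu>"
    using \<mu>(1) \<epsilon> by (subst (asm) ennreal_le_iff) (auto intro!: add_nonneg_nonneg mult_nonneg_nonneg simp: ell_mass_nonneg Lp_mass_nonneg)
  then show ?thesis using \<mu>(1) by (simp add: field_simps)
qed

lemma lattice_synthesis_lower_bound:
  fixes \<phi> :: "real ^ 'n \<Rightarrow> complex"
  assumes p: "0 < p" "p \<le> 1" and \<phi>: "\<phi> \<in> Lp_fun p" and supp: "compactly_supported \<phi>"
    and nz: "\<And>\<eta>. \<not> (AE y in lebesgue. fourier (lattice_sample \<phi> y) \<eta> = 0)"
  shows "\<exists>C>0. \<forall>s\<in>ell p. ell_mass p s \<le> C * Lp_mass p (lattice_synthesis \<phi> s)"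
proof -
  let ?f = "lattice_sample \<phi>"
  \<comment> \<open>Almost every y is \<open>good\<close>, so for each \<eta> the nonvanishing
    hypothesis can be witnessed at a point where the sample is finitely supported and
    approximable.\<close>
  define good where "good y \<longleftrightarrow> finite {k. ?f y k \<noteq> 0} \<and>
    (\<forall>\<epsilon>>0. \<exists>E\<in>sets lebesgue. E \<subseteq> ball y (1/2) \<and> \<not> negligible E \<and>
       (AE z in lebesgue. z \<in> E \<longrightarrow> ?f z \<in> ell p \<and> ell_mass p (\<lambda>k. ?f y k - ?f z k) \<le> \<epsilon>))" for y
  have AE_good: "AE y in lebesgue. good y"
    unfolding good_def using \<phi> by (intro AE_sample_approximation p supp) (simp add: Lp_fun_def)
  have "\<exists>y. good y \<and> fourier (?f y) \<eta> \<noteq> 0" for \<eta>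
  proof (rule ccontr)
    assume "\<not> ?thesis"
    then have "fourier (?f y) \<eta> = 0" if "good y" for y using that by blast
    then have "AE y in lebesgue. fourier (?f y) \<eta> = 0" by (rule eventually_mono[OF AE_good])
    with nz show False by blast
  qed
  then obtain Y where Y: "\<And>\<eta>. good (Y \<eta>)" "\<And>\<eta>. fourier (?f (Y \<eta>)) \<eta> \<noteq> 0" by metis
  \<comment> \<open>Finite support makes each Fourier series continuous, so its nonvanishing at one
    frequency persists nearby and the cube is covered by open sets.\<close>
  have op: "open {\<eta>. fourier (?f (Y \<zeta>)) \<eta> \<noteq> 0}" for \<zeta>
    using Y(1)[of \<zeta>] by (intro open_Collect_neq continuous_fourier_finite_support continuous_on_const) (auto simp: good_def)
  have cover: "cbox 0 1 \<subseteq> (\<Union>\<zeta>\<in>UNIV. {\<eta>. fourier (?f (Y \<zeta>)) \<eta> \<noteq> 0})"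
    using Y(2) by blast
  obtain D where D: "finite D" "cbox 0 1 \<subseteq> (\<Union>\<zeta>\<in>D. {\<eta>. fourier (?f (Y \<zeta>)) \<eta> \<noteq> 0})"
    by (rule compactE_image[OF compact_cbox op cover])
  have "\<exists>C>0. \<forall>s\<in>ell p. ell_mass p s \<le> C * (\<Sum>\<zeta>\<in>D. ell_mass p (conv (?f (Y \<zeta>)) s))"
  proof (rule deconvolution[OF p D(1)])
    show "finite {k. ?f (Y \<zeta>) k \<noteq> 0}" for \<zeta> using Y(1)[of \<zeta>] by (simp add: good_def)
  qed (use D(2) in auto)
  then obtain C where C: "C > 0" and
    dec: "\<And>s. s \<in> ell p \<Longrightarrow> ell_mass p s \<le> C * (\<Sum>\<zeta>\<in>D. ell_mass p (conv (?f (Y \<zeta>)) s))" by blast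
  \<comment> \<open>Makes C times the sum of the \<open>card D\<close> error terms at most half of
    \<open>ell_mass p s\<close>, so that the errors can be absorbed on the left; this fixes the sets
    E before s is given.\<close>
  define \<epsilon> where "\<epsilon> = 1 / (2 * C * (card D + 1))"
  have \<epsilon>: "\<epsilon> > 0" using C by (simp add: \<epsilon>_def)
  define Q where "Q \<zeta> E \<longleftrightarrow> E \<in> sets lebesgue \<and> E \<subseteq> ball (Y \<zeta>) (1/2) \<and> \<not> negligible E \<and>
       (AE z in lebesgue. z \<in> E \<longrightarrow> ?f z \<in> ell p \<and> ell_mass p (\<lambda>k. ?f (Y \<zeta>) k - ?f z k) \<le> \<epsilon>)" for \<zeta> E
  have "\<exists>E. Q \<zeta> E" for \<zeta>
    using Y(1)[of \<zeta>] \<epsilon> unfolding good_def Q_def by blast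
  then obtain E where "\<And>\<zeta>. Q \<zeta> (E \<zeta>)" by metis
  then have E: "E \<zeta> \<in> sets lebesgue" "E \<zeta> \<subseteq> ball (Y \<zeta>) (1/2)" "\<not> negligible (E \<zeta>)"
    "AE z in lebesgue. z \<in> E \<zeta> \<longrightarrow> ?f z \<in> ell p \<and> ell_mass p (\<lambda>k. ?f (Y \<zeta>) k - ?f z k) \<le> \<epsilon>" for \<zeta>
    unfolding Q_def by blast+
  define M where "M = (\<Sum>\<zeta>\<in>D. 1 / measure lebesgue (E \<zeta>))"
  have M: "0 \<le> M" unfolding M_def by (intro sum_nonneg) simp
  have "ell_mass p s \<le> (2 * C * M + 1) * Lp_mass p (lattice_synthesis \<phi> s)" if s: "s \<in> ell p" for s
  proof -
    let ?L = "Lp_mass p (lattice_synthesis \<phi> s)"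
    have "(\<Sum>\<zeta>\<in>D. ell_mass p (conv (?f (Y \<zeta>)) s)) \<le> (\<Sum>\<zeta>\<in>D. ?L / measure lebesgue (E \<zeta>) + \<epsilon> * ell_mass p s)"
      by (intro sum_mono sample_estimate[OF p \<phi> s E(1-3) _ E(4)])
         (use Y(1) \<epsilon> in \<open>auto simp: good_def\<close>)
    also have "\<dots> = M * ?L + card D * (\<epsilon> * ell_mass p s)"
      by (simp add: sum.distrib M_def sum_distrib_right)
    finally have "ell_mass p s \<le> C * (M * ?L + card D * (\<epsilon> * ell_mass p s))"
      using dec[OF s] C by (meson mult_left_mono less_imp_le order_trans)
    moreover have "C * (card D * (\<epsilon> * ell_mass p s)) \<le> ell_mass p s / 2"
    proof -
      have "C * (card D * \<epsilon>) = card D / (2 * (card D + 1))" using C by (simp add: \<epsilon>_def)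
      also have "\<dots> \<le> 1 / 2" by (simp add: field_simps)
      finally have "C * (card D * \<epsilon>) \<le> 1 / 2" .
      then have "C * (card D * \<epsilon>) * ell_mass p s \<le> 1 / 2 * ell_mass p s"
        by (rule mult_right_mono[OF _ ell_mass_nonneg])
      then show ?thesis by (simp add: mult_ac)
    qed
    ultimately have "ell_mass p s \<le> 2 * C * M * ?L" by (simp add: algebra_simps)
    then show ?thesis using Lp_mass_nonneg[of p "lattice_synthesis \<phi> s"] by (simp add: algebra_simps)
  qed
  moreover have "0 < 2 * C * M + 1" using C M by (intro add_nonneg_pos mult_nonneg_nonneg) auto
  ultimately show ?thesis by blast
qed

section \<open>Closed range\<close>

text \<open>The limit is taken coordinate by coordinate; the Cauchy bounds pass to it through finite
  partial sums.\<close>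

lemma ell_complete:
  fixes s :: "nat \<Rightarrow> 'k \<Rightarrow> complex"
  assumes p: "0 < p" "p \<le> 1" and s: "\<And>n. s n \<in> ell p"
    and Cauchy: "\<And>\<epsilon>. \<epsilon> > 0 \<Longrightarrow> \<exists>N. \<forall>m\<ge>N. \<forall>n\<ge>N. ell_mass p (\<lambda>k. s m k - s n k) \<le> \<epsilon>"
  shows "\<exists>t\<in>ell p. \<forall>\<epsilon>>0. \<exists>N. \<forall>n\<ge>N. ell_mass p (\<lambda>k. s n k - t k) \<le> \<epsilon>"
proof -
  have part: "(\<Sum>k\<in>F. norm (u k) powr p) \<le> ell_mass p u" if "u \<in> ell p" "finite F" for u :: "'k \<Rightarrow> complex" and F
    using that unfolding ell_def ell_mass_def by (intro finite_sum_le_infsum) auto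
  have "convergent (\<lambda>n. s n k)" for k
  proof (rule Cauchy_convergent, rule CauchyI')
    fix e :: real assume e: "e > 0"
    obtain N where N: "\<And>m n. m \<ge> N \<Longrightarrow> n \<ge> N \<Longrightarrow> ell_mass p (\<lambda>k. s m k - s n k) \<le> (e/2) powr p"
      using Cauchy[of "(e/2) powr p"] e by auto
    have "dist (s m k) (s n k) < e" if "m \<ge> N" "n \<ge> N" for m n
    proof -
      have "norm (s m k - s n k) powr p \<le> (e/2) powr p"
        using part[OF ell_diff(1)[OF p s s], of "{k}" m n] N[OF that] by simp
      then have "\<not> e/2 < norm (s m k - s n k)"
        using powr_less_mono2[of p "e/2" "norm (s m k - s n k)"] p e by auto
      then show ?thesis using e by (simp add: dist_norm)
    qed
    then show "\<exists>M. \<forall>m\<ge>M. \<forall>n>m. dist (s m k) (s n k) < e" by (intro exI[of _ N]) auto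
  qed
  then obtain t where t: "\<And>k. (\<lambda>n. s n k) \<longlonglongrightarrow> t k" unfolding convergent_def by metis
  have lim: "\<exists>N. \<forall>n\<ge>N. (\<lambda>k. s n k - t k) \<in> ell p \<and> ell_mass p (\<lambda>k. s n k - t k) \<le> \<epsilon>" if \<epsilon>: "\<epsilon> > 0" for \<epsilon>
  proof -
    obtain N where N: "\<And>m n. m \<ge> N \<Longrightarrow> n \<ge> N \<Longrightarrow> ell_mass p (\<lambda>k. s m k - s n k) \<le> \<epsilon>"
      using Cauchy[OF \<epsilon>] by blast
    have "(\<lambda>k. s n k - t k) \<in> ell p \<and> ell_mass p (\<lambda>k. s n k - t k) \<le> \<epsilon>" if n: "n \<ge> N" for n
    proof -
      \<comment> \<open>For a fixed finite F the non-strict Cauchy bound survives the limit in m,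
        and it is uniform in F.\<close>
      have fin: "(\<Sum>k\<in>F. norm (s n k - t k) powr p) \<le> \<epsilon>" if F: "finite F" for F
      proof (rule tendsto_upperbound)
        show "(\<lambda>m. \<Sum>k\<in>F. norm (s n k - s m k) powr p) \<longlonglongrightarrow> (\<Sum>k\<in>F. norm (s n k - t k) powr p)"
          using p by (intro tendsto_sum tendsto_powr' tendsto_norm tendsto_diff tendsto_const t) auto
        show "\<forall>\<^sub>F m in sequentially. (\<Sum>k\<in>F. norm (s n k - s m k) powr p) \<le> \<epsilon>"
          using eventually_ge_at_top[of N]
          by eventually_elim (use part[OF ell_diff(1)[OF p s s] F] N[OF n] order_trans in blast)
      qed simp
      have sm: "(\<lambda>k. norm (s n k - t k) powr p) summable_on UNIV"
        by (rule nonneg_bdd_above_summable_on) (use fin in \<open>auto intro!: bdd_aboveI2\<close>)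
      then have "ell_mass p (\<lambda>k. s n k - t k) \<le> \<epsilon>"
        unfolding ell_mass_def by (rule infsum_le_finite_sums) (use fin in auto)
      with sm show ?thesis by (simp add: ell_def)
    qed
    then show ?thesis by blast
  qed
  obtain N where "(\<lambda>k. s N k - t k) \<in> ell p" using lim[of 1] by auto
  then have "(\<lambda>k. s N k - (s N k - t k)) \<in> ell p" by (rule ell_diff(1)[OF p s])
  then have t_ell: "t \<in> ell p" by simp
  show ?thesis
  proof (intro bexI[OF _ t_ell] allI impI)
    fix \<epsilon> :: real assume "\<epsilon> > 0"
    from lim[OF this] show "\<exists>N. \<forall>n\<ge>N. ell_mass p (\<lambda>k. s n k - t k) \<le> \<epsilon>" by meson
  qed
qed

text \<open>The lower bound turns a convergent sequence of images into a Cauchy sequence of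
  coefficients, completeness gives a limit, and the upper bound shows that its image is the given
  limit.\<close>

lemma closed_range:
  fixes S :: "('k \<Rightarrow> complex) \<Rightarrow> 'a::euclidean_space \<Rightarrow> complex"
  assumes p: "0 < p" "p \<le> 1" and Lp: "\<And>s. s \<in> ell p \<Longrightarrow> S s \<in> Lp_fun p"
    and diff: "\<And>s t. s \<in> ell p \<Longrightarrow> t \<in> ell p \<Longrightarrow> AE x in lebesgue. S (\<lambda>k. s k - t k) x = S s x - S t x"
    and upper: "\<And>s. s \<in> ell p \<Longrightarrow> Lp_mass p (S s) \<le> K * ell_mass p s"
    and lower: "\<And>s. s \<in> ell p \<Longrightarrow> ell_mass p s \<le> C * Lp_mass p (S s)"
  shows "closedin (Lp_topology p) ((\<lambda>s. ae_class (S s)) ` ell p)"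
proof -
  interpret Metric_space "Lp p :: ('a \<Rightarrow> complex) set set" "Lp_dist p" by (rule Metric_space_Lp[OF p])
  let ?S = "\<lambda>s. ae_class (S s)"
  have meas: "S s \<in> borel_measurable lebesgue" if "s \<in> ell p" for s using Lp[OF that] by (simp add: Lp_fun_def)
  have inLp: "?S s \<in> Lp p" if "s \<in> ell p" for s using Lp[OF that] by (auto simp: Lp_def)
  have dist: "Lp_dist p (?S s) (?S t) = Lp_mass p (S (\<lambda>k. s k - t k))" if st: "s \<in> ell p" "t \<in> ell p" for s t
  proof -
    have [measurable]: "S s \<in> borel_measurable lebesgue" "S t \<in> borel_measurable lebesgue"
      "S (\<lambda>k. s k - t k) \<in> borel_measurable lebesgue"
      by (intro meas st ell_diff(1) p)+
    have "Lp_dist p (?S s) (?S t) = (\<integral>x. norm (S s x - S t x) powr p \<partial>lebesgue)"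
      by (rule Lp_dist_ae_class[OF p(1)]) auto
    also have "\<dots> = Lp_mass p (S (\<lambda>k. s k - t k))"
      unfolding Lp_mass_def
    proof (rule integral_cong_AE)
      show "AE x in lebesgue. norm (S s x - S t x) powr p = norm (S (\<lambda>k. s k - t k) x) powr p"
        using diff[OF st] by eventually_elim simp
    qed auto
    finally show ?thesis .
  qed
  show ?thesis
    unfolding metric_closedin_iff_sequentially_closed
  proof (intro conjI allI impI)
    show "?S ` ell p \<subseteq> Lp p" using inLp by auto
    fix \<sigma> l assume \<sigma>l: "range \<sigma> \<subseteq> ?S ` ell p \<and> limitin mtopology \<sigma> l sequentially"
    have \<sigma>: "\<exists>s\<in>ell p. \<sigma> n = ?S s" for n
    proof -
      have "\<sigma> n \<in> ?S ` ell p" using \<sigma>l by blast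
      then show ?thesis by (rule imageE) blast
    qed
    have l: "l \<in> Lp p" and lim': "\<forall>\<epsilon>>0. \<exists>N. \<forall>n\<ge>N. \<sigma> n \<in> Lp p \<and> Lp_dist p (\<sigma> n) l < \<epsilon>"
      using \<sigma>l by (simp_all add: limit_metric_sequentially)
    have lim: "\<exists>N. \<forall>n\<ge>N. Lp_dist p (\<sigma> n) l < \<epsilon>" if "\<epsilon> > 0" for \<epsilon>
      using lim'[rule_format, OF that] by meson
    obtain s where s: "\<And>n. s n \<in> ell p" "\<And>n. \<sigma> n = ?S (s n)" using \<sigma> by metis
    \<comment> \<open>Positive majorants of C and K, so that division by them is legitimate
      below.\<close>
    define C' where "C' = \<bar>C\<bar> + 1"
    define K' where "K' = \<bar>K\<bar> + 1"
    have C'K': "C' > 0" "K' > 0" "C \<le> C'" "K \<le> K'" by (auto simp: C'_def K'_def)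
    have lower': "ell_mass p u \<le> C' * Lp_mass p (S u)" if "u \<in> ell p" for u
      using lower[OF that] mult_right_mono[OF C'K'(3) Lp_mass_nonneg] order_trans by blast
    have upper': "Lp_mass p (S u) \<le> K' * ell_mass p u" if "u \<in> ell p" for u
      using upper[OF that] mult_right_mono[OF C'K'(4) ell_mass_nonneg] order_trans by blast
    have Cauchy: "\<exists>N. \<forall>m\<ge>N. \<forall>n\<ge>N. ell_mass p (\<lambda>k. s m k - s n k) \<le> \<epsilon>" if \<epsilon>: "\<epsilon> > 0" for \<epsilon>
    proof -
      obtain N where N: "\<And>n. n \<ge> N \<Longrightarrow> Lp_dist p (\<sigma> n) l < \<epsilon> / (2 * C')"
        using lim[of "\<epsilon> / (2 * C')"] \<epsilon> C'K' by auto
      have "ell_mass p (\<lambda>k. s m k - s n k) \<le> \<epsilon>" if "m \<ge> N" "n \<ge> N" for m n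
      proof -
        have "Lp_dist p (\<sigma> m) (\<sigma> n) \<le> Lp_dist p (\<sigma> m) l + Lp_dist p l (\<sigma> n)"
          using s inLp l by (intro triangle) auto
        also have "Lp_dist p l (\<sigma> n) = Lp_dist p (\<sigma> n) l" by (rule commute)
        finally have "Lp_dist p (\<sigma> m) (\<sigma> n) \<le> \<epsilon> / C'"
          using N[OF that(1)] N[OF that(2)] by (simp add: field_simps)
        then have "Lp_mass p (S (\<lambda>k. s m k - s n k)) \<le> \<epsilon> / C'" by (simp add: s dist)
        then have "C' * Lp_mass p (S (\<lambda>k. s m k - s n k)) \<le> \<epsilon>" using C'K' by (simp add: field_simps)
        then show ?thesis using lower'[OF ell_diff(1)[OF p s(1) s(1)]] order_trans by blast
      qed
      then show ?thesis by blast
    qed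
    from ell_complete[OF p s(1) Cauchy] obtain t where t: "t \<in> ell p"
      "\<forall>\<epsilon>>0. \<exists>N. \<forall>n\<ge>N. ell_mass p (\<lambda>k. s n k - t k) \<le> \<epsilon>"
      by (rule bexE)
    have "Lp_dist p l (?S t) \<le> \<epsilon>" if \<epsilon>: "\<epsilon> > 0" for \<epsilon>
    proof -
      obtain N where N: "\<And>n. n \<ge> N \<Longrightarrow> Lp_dist p (\<sigma> n) l < \<epsilon> / 2" using lim[of "\<epsilon> / 2"] \<epsilon> by auto
      obtain N' where N': "\<And>n. n \<ge> N' \<Longrightarrow> ell_mass p (\<lambda>k. s n k - t k) \<le> \<epsilon> / (2 * K')"
        using t(2)[rule_format, of "\<epsilon> / (2 * K')"] \<epsilon> C'K' by auto
      define n where "n = max N N'"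
      have "Lp_dist p l (?S t) \<le> Lp_dist p l (\<sigma> n) + Lp_dist p (\<sigma> n) (?S t)"
        using s inLp l t by (intro triangle) auto
      also have "Lp_dist p l (\<sigma> n) = Lp_dist p (\<sigma> n) l" by (rule commute)
      also have "\<dots> \<le> \<epsilon> / 2" using N[of n] by (simp add: n_def)
      also have "Lp_dist p (\<sigma> n) (?S t) \<le> K' * ell_mass p (\<lambda>k. s n k - t k)"
        using upper'[OF ell_diff(1)[OF p s(1) t(1)]] by (simp add: s dist t)
      also have "\<dots> \<le> K' * (\<epsilon> / (2 * K'))"
        using N'[of n] C'K' by (intro mult_left_mono) (auto simp: n_def)
      also have "\<dots> = \<epsilon> / 2" using C'K' by simp
      finally show ?thesis by simp
    qed
    then have "Lp_dist p l (?S t) \<le> 0" by (meson dense not_le)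
    then have "l = ?S t" using l inLp[OF t(1)] nonneg[of l "?S t"] zero by (metis antisym)
    then show "l \<in> ?S ` ell p" using t(1) by blast
  qed
qed

section \<open>Reduction to the integer lattice\<close>

lemma Lp_fun_matrix:
  fixes A :: "real ^ 'n ^ 'n"
  assumes A: "invertible A" and f: "f \<in> Lp_fun p"
  shows "(\<lambda>x. f (A *v x)) \<in> Lp_fun p"
    and "\<bar>det A\<bar> * Lp_mass p (\<lambda>x. f (A *v x)) = Lp_mass p f"
proof -
  have fm [measurable]: "f \<in> borel_measurable lebesgue" using f by (simp add: Lp_fun_def)
  have m: "(\<lambda>x. f (A *v x)) \<in> borel_measurable lebesgue"
    by (rule measurable_compose[OF measurable_matrix_lebesgue[OF A] fm])
  have det: "\<bar>det A\<bar> > 0" using A by (simp add: invertible_det_nz)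
  have eq: "ennreal \<bar>det A\<bar> * (\<integral>\<^sup>+x. ennreal (norm (f (A *v x)) powr p) \<partial>lebesgue) = ennreal (Lp_mass p f)"
    using nn_integral_matrix[OF A, of "\<lambda>x. ennreal (norm (f x) powr p)"] by (simp add: nn_integral_Lp_mass[OF f])
  have "(\<integral>\<^sup>+x. ennreal (norm (f (A *v x)) powr p) \<partial>lebesgue)
      = ennreal (1 / \<bar>det A\<bar>) * (ennreal \<bar>det A\<bar> * (\<integral>\<^sup>+x. ennreal (norm (f (A *v x)) powr p) \<partial>lebesgue))"
    using det by (simp add: mult.assoc[symmetric] ennreal_mult[symmetric])
  also have "\<dots> = ennreal (1 / \<bar>det A\<bar> * Lp_mass p f)"
    unfolding eq by (subst ennreal_mult) (auto simp: Lp_mass_nonneg)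
  finally have "(\<integral>\<^sup>+x. ennreal (norm (f (A *v x)) powr p) \<partial>lebesgue) \<le> ennreal (1 / \<bar>det A\<bar> * Lp_mass p f)"
    by simp
  then show F: "(\<lambda>x. f (A *v x)) \<in> Lp_fun p"
    by (rule Lp_funI(1)[OF m, rotated]) (simp add: Lp_mass_nonneg)
  have "ennreal (\<bar>det A\<bar> * Lp_mass p (\<lambda>x. f (A *v x))) = ennreal (Lp_mass p f)"
    using eq by (simp add: nn_integral_Lp_mass[OF F] ennreal_mult Lp_mass_nonneg)
  then show "\<bar>det A\<bar> * Lp_mass p (\<lambda>x. f (A *v x)) = Lp_mass p f"
    by (simp add: Lp_mass_nonneg)
qed

lemma invertible_matrix_inv:
  fixes b :: "real ^ 'n ^ 'n"
  assumes "invertible b"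
  shows "invertible (matrix_inv b)"
  unfolding invertible_def using matrix_inv_cancel[OF assms]
  by (intro exI[of _ b]) (simp add: matrix_eq flip: matrix_vector_mul_assoc)

lemma Lp_fun_cmult:
  assumes "f \<in> Lp_fun p"
  shows "(\<lambda>x. c * f x) \<in> Lp_fun p" and "Lp_mass p (\<lambda>x. c * f x) = norm c powr p * Lp_mass p f"
  using assms by (auto simp: Lp_fun_def Lp_mass_def norm_mult powr_mult)

lemma synthesis_eq_lattice_synthesis:
  fixes b :: "real ^ 'n ^ 'n"
  assumes b: "invertible b"
  shows "synthesis p a b \<psi> j s x = of_real (\<bar>det (a j)\<bar> powr (1 / p))
    * lattice_synthesis (\<lambda>y. \<psi> (b *v y)) s ((matrix_inv b ** a j) *v x)"
proof -
  have "b *v ((matrix_inv b ** a j) *v x - lattice_point k) = a j *v x - b *v lattice_point k" for k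
    by (simp add: matrix_vector_mult_diff_distrib matrix_inv_cancel[OF b] flip: matrix_vector_mul_assoc)
  then show ?thesis
    by (simp add: synthesis_def affine_fun_def lattice_synthesis_def mult.left_commute flip: infsum_cmult_right')
qed

text \<open>The squared-off normalisation contributes |det a_j|, which equals |det b| |det T| for
  the substitution matrix T; the Jacobian removes |det T|. The remaining factor |det b| does not
  involve j.\<close>

lemma synthesis_Lp:
  fixes b :: "real ^ 'n ^ 'n"
  assumes p: "0 < p" "p \<le> 1" and b: "invertible b" and a: "invertible (a j)" and \<psi>: "\<psi> \<in> Lp_fun p"
    and s: "s \<in> ell p"
  shows "synthesis p a b \<psi> j s \<in> Lp_fun p"
    and "Lp_mass p (synthesis p a b \<psi> j s) = \<bar>det b\<bar> * Lp_mass p (lattice_synthesis (\<lambda>y. \<psi> (b *v y)) s)"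
proof -
  let ?T = "matrix_inv b ** a j" and ?U = "lattice_synthesis (\<lambda>y. \<psi> (b *v y)) s"
  let ?c = "of_real (\<bar>det (a j)\<bar> powr (1 / p)) :: complex"
  have T: "invertible ?T"
    by (rule invertible_mult[OF invertible_matrix_inv[OF b] a])
  have "b ** matrix_inv b = mat 1"
    by (simp add: matrix_eq matrix_inv_cancel[OF b] flip: matrix_vector_mul_assoc)
  then have "det b * det (matrix_inv b) = 1" by (simp flip: det_mul)
  then have det: "\<bar>det (a j)\<bar> = \<bar>det b\<bar> * \<bar>det ?T\<bar>" by (simp add: det_mul flip: abs_mult mult.assoc)
  have U: "?U \<in> Lp_fun p" by (rule lattice_synthesis_bound(2)[OF p Lp_fun_matrix(1)[OF b \<psi>] s])
  have eq: "synthesis p a b \<psi> j s = (\<lambda>x. ?c * ?U (?T *v x))"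
    by (rule ext) (rule synthesis_eq_lattice_synthesis[OF b])
  show "synthesis p a b \<psi> j s \<in> Lp_fun p"
    unfolding eq by (intro Lp_fun_cmult Lp_fun_matrix(1)[OF T] U)
  have "Lp_mass p (synthesis p a b \<psi> j s) = norm ?c powr p * Lp_mass p (\<lambda>x. ?U (?T *v x))"
    unfolding eq by (rule Lp_fun_cmult(2)[OF Lp_fun_matrix(1)[OF T U]])
  also have "norm ?c powr p = \<bar>det b\<bar> * \<bar>det ?T\<bar>"
    using p by (simp add: powr_powr flip: det)
  finally show "Lp_mass p (synthesis p a b \<psi> j s) = \<bar>det b\<bar> * Lp_mass p ?U"
    using Lp_fun_matrix(2)[OF T U] by (simp add: mult.assoc)
qed

lemma synthesis_diff:
  fixes b :: "real ^ 'n ^ 'n"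
  assumes p: "0 < p" "p \<le> 1" and b: "invertible b" and a: "invertible (a j)" and \<psi>: "\<psi> \<in> Lp_fun p"
    and s: "s \<in> ell p" and t: "t \<in> ell p"
  shows "AE x in lebesgue. synthesis p a b \<psi> j (\<lambda>k. s k - t k) x = synthesis p a b \<psi> j s x - synthesis p a b \<psi> j t x"
proof -
  have T: "invertible (matrix_inv b ** a j)"
    by (rule invertible_mult[OF invertible_matrix_inv[OF b] a])
  show ?thesis
    using AE_matrix[OF T lattice_synthesis_diff[OF p Lp_fun_matrix(1)[OF b \<psi>] s t]]
    by eventually_elim (simp only: synthesis_eq_lattice_synthesis[OF b] right_diff_distrib)
qed

text \<open>The frequency \<open>\<eta> v* matrix_inv b\<close> is chosen so that its pairing with b
  z equals that of \<eta> with z. Reflecting k turns the periodization into the Fourier series of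
  the sample, up to factors that never vanish.\<close>

lemma periodization_eq_fourier:
  fixes b :: "real ^ 'n ^ 'n"
  assumes b: "invertible b"
  shows "periodization b (\<lambda>y. character (\<eta> v* matrix_inv b) y * \<psi> y) (b *v y)
    = of_real \<bar>det b\<bar> * character \<eta> y * fourier (lattice_sample (\<lambda>y. \<psi> (b *v y)) y) \<eta>"
proof -
  have char: "character (\<eta> v* matrix_inv b) (b *v z) = character \<eta> z" for z
    by (simp add: character_def dot_lmul_matrix matrix_inv_cancel[OF b])
  have "(\<Sum>\<^sub>\<infinity>k. character (\<eta> v* matrix_inv b) (b *v y - b *v lattice_point k) * \<psi> (b *v y - b *v lattice_point k))
      = (\<Sum>\<^sub>\<infinity>k. character \<eta> (y - lattice_point k) * \<psi> (b *v (y - lattice_point k)))"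
    by (simp add: char flip: matrix_vector_mult_diff_distrib)
  also have "\<dots> = (\<Sum>\<^sub>\<infinity>k. character \<eta> (y + lattice_point k) * \<psi> (b *v (y + lattice_point k)))"
    by (rule infsum_reindex_bij_witness[of _ uminus uminus]) (auto simp: lattice_point_minus)
  also have "\<dots> = character \<eta> y * fourier (lattice_sample (\<lambda>y. \<psi> (b *v y)) y) \<eta>"
    by (simp add: fourier_def lattice_sample_def character_add mult_ac flip: infsum_cmult_right')
  finally show ?thesis by (simp add: periodization_def mult.assoc)
qed

lemma compactly_supported_matrix:
  fixes b :: "real ^ 'n ^ 'n"
  assumes b: "invertible b" and "compactly_supported \<psi>"
  shows "compactly_supported (\<lambda>y. \<psi> (b *v y))"
proof -
  obtain K where K: "compact K" "AE x in lebesgue. x \<notin> K \<longrightarrow> \<psi> x = 0"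
    using assms(2) by (auto simp: compactly_supported_def)
  have "compact ((*v) (matrix_inv b) ` K)"
    by (intro compact_continuous_image K(1) linear_continuous_on linear_linear[THEN iffD2] matrix_vector_mul_linear)
  moreover have "AE y in lebesgue. y \<notin> (*v) (matrix_inv b) ` K \<longrightarrow> \<psi> (b *v y) = 0"
    using AE_matrix[OF b K(2)] by eventually_elim (use matrix_vimage_eq[OF b, of K] in blast)
  ultimately show ?thesis unfolding compactly_supported_def by blast
qed

text \<open>The two constants are quantified before the dilations and j, which expresses that they
  depend on \<psi>, b and p only.\<close>

theorem theorem10:
  fixes p :: real and b :: "real ^ 'n ^ 'n" and \<psi> :: "real ^ 'n \<Rightarrow> complex"
  assumes "0 < p" and "p \<le> 1"
    and "invertible b"
    and "\<psi> \<in> Lp_fun p"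
    and "\<forall>\<xi>. \<not> (AE x in lebesgue. periodization b (\<lambda>y. character \<xi> y * \<psi> y) x = 0)"
  shows "(\<forall>a. expanding_dilations a \<longrightarrow>
            (\<forall>j>0. Lp_synthesis p a b \<psi> j \<in> ell p \<rightarrow> Lp p \<and>
                   inj_on (Lp_synthesis p a b \<psi> j) (ell p))) \<and>
         (compactly_supported \<psi> \<longrightarrow>
            (\<exists>C\<^sub>1>0. \<exists>C\<^sub>2>0. \<forall>a. expanding_dilations a \<longrightarrow>
               (\<forall>j>0. \<forall>s \<in> ell p.
                  C\<^sub>1 * Lp_norm p (synthesis p a b \<psi> j s) \<le> ell_norm p s \<and>
                  ell_norm p s \<le> C\<^sub>2 * Lp_norm p (synthesis p a b \<psi> j s))) \<and>
            (\<forall>a. expanding_dilations a \<longrightarrow>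
               (\<forall>j>0. closedin (Lp_topology p) (Lp_synthesis p a b \<psi> j ` ell p))))"
proof -
  note p = assms(1,2) and b = assms(3) and \<psi> = assms(4)
  let ?\<phi> = "\<lambda>y. \<psi> (b *v y)"
  have \<phi>: "?\<phi> \<in> Lp_fun p" by (rule Lp_fun_matrix(1)[OF b \<psi>])
  have det: "\<bar>det b\<bar> > 0" using b by (simp add: invertible_det_nz)
  have nz: "\<not> (AE y in lebesgue. fourier (lattice_sample ?\<phi> y) \<eta> = 0)" for \<eta>
  proof
    assume "AE y in lebesgue. fourier (lattice_sample ?\<phi> y) \<eta> = 0"
    then have "AE y in lebesgue. periodization b (\<lambda>y. character (\<eta> v* matrix_inv b) y * \<psi> y) (b *v y) = 0"
      by eventually_elim (simp add: periodization_eq_fourier[OF b])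
    \<comment> \<open>Substituting y = b^-1 x returns to the variable of the hypothesis,
      contradicting it at the frequency \<eta> b^-1.\<close>
    then have "AE x in lebesgue. periodization b (\<lambda>y. character (\<eta> v* matrix_inv b) y * \<psi> y) (b *v (matrix_inv b *v x)) = 0"
      by (rule AE_matrix[OF invertible_matrix_inv[OF b]])
    then show False using assms(5) by (simp add: matrix_inv_cancel[OF b])
  qed
  have inva: "invertible (a j)" if "expanding_dilations a" "j > 0" for a :: "nat \<Rightarrow> real ^ 'n ^ 'n" and j
    using that by (simp add: expanding_dilations_def)
  have into: "Lp_synthesis p a b \<psi> j \<in> ell p \<rightarrow> Lp p" if "invertible (a j)" for a j
    using synthesis_Lp(1)[where a = a and j = j, OF p b that \<psi>] by (auto simp: Lp_synthesis_def Lp_def)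
  have inj: "inj_on (Lp_synthesis p a b \<psi> j) (ell p)" if a: "invertible (a j)" for a j
  proof (rule inj_onI)
    fix s t assume st: "s \<in> ell p" "t \<in> ell p" and eq: "Lp_synthesis p a b \<psi> j s = Lp_synthesis p a b \<psi> j t"
    have d: "(\<lambda>k. s k - t k) \<in> ell p" by (rule ell_diff(1)[OF p st])
    have "synthesis p a b \<psi> j s \<in> borel_measurable lebesgue"
      using synthesis_Lp(1)[where a = a and j = j, OF p b a \<psi> st(1)] by (simp add: Lp_fun_def)
    then have "AE x in lebesgue. synthesis p a b \<psi> j s x = synthesis p a b \<psi> j t x"
      using eq by (simp add: Lp_synthesis_def ae_class_eq_iff)
    with synthesis_diff[where a = a and j = j, OF p b a \<psi> st] have "AE x in lebesgue. norm (synthesis p a b \<psi> j (\<lambda>k. s k - t k) x) powr p = 0"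
      by eventually_elim simp
    \<comment> \<open>Vanishing is passed from the variable x to y through masses, which agree up to
      the positive factor |det b|.\<close>
    then have "Lp_mass p (synthesis p a b \<psi> j (\<lambda>k. s k - t k)) = 0"
      unfolding Lp_mass_def by (rule integral_eq_zero_AE)
    then have zero: "Lp_mass p (lattice_synthesis ?\<phi> (\<lambda>k. s k - t k)) = 0"
      using synthesis_Lp(2)[where a = a and j = j, OF p b a \<psi> d] det by simp
    have "lattice_synthesis ?\<phi> (\<lambda>k. s k - t k) \<in> Lp_fun p" by (rule lattice_synthesis_bound(2)[OF p \<phi> d])
    then have "AE y in lebesgue. norm (lattice_synthesis ?\<phi> (\<lambda>k. s k - t k) y) powr p = 0"
      using zero integral_nonneg_eq_0_iff_AE[of lebesgue "\<lambda>x. norm (lattice_synthesis ?\<phi> (\<lambda>k. s k - t k) x) powr p"]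
      by (simp add: Lp_mass_def Lp_fun_def)
    then have "AE y in lebesgue. lattice_synthesis ?\<phi> (\<lambda>k. s k - t k) y = 0" by simp
    then have "(\<lambda>k. s k - t k) = (\<lambda>_. 0)"
      by (rule lattice_synthesis_zero_imp[OF nz ell_subset_ell_1[OF p d]])
    then show "s = t" by (simp add: fun_eq_iff)
  qed
  have Lp_norm_eq: "Lp_norm p f = Lp_mass p f powr (1 / p)" for f :: "real ^ 'n \<Rightarrow> complex"
    by (simp add: Lp_norm_def Lp_mass_def)
  have ell_norm_eq: "ell_norm p s = ell_mass p s powr (1 / p)" for s :: "int ^ 'n \<Rightarrow> complex"
    by (simp add: ell_norm_def ell_mass_def)
  \<comment> \<open>The upper bound for masses, increased by 1 so that it is positive and can be
    inverted.\<close>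
  define K where "K = \<bar>det b\<bar> * Lp_mass p ?\<phi> + 1"
  have K: "K > 0" unfolding K_def by (intro add_nonneg_pos mult_nonneg_nonneg Lp_mass_nonneg) auto
  have upper: "Lp_mass p (synthesis p a b \<psi> j s) \<le> K * ell_mass p s" if a: "invertible (a j)" and s: "s \<in> ell p" for a j s
  proof -
    have "Lp_mass p (synthesis p a b \<psi> j s) \<le> \<bar>det b\<bar> * (ell_mass p s * Lp_mass p ?\<phi>)"
      unfolding synthesis_Lp(2)[where a = a and j = j, OF p b a \<psi> s] by (intro mult_left_mono lattice_synthesis_bound(3)[OF p \<phi> s]) simp
    also have "\<dots> \<le> K * ell_mass p s" by (simp add: K_def algebra_simps ell_mass_nonneg)
    finally show ?thesis .
  qed
  have compact: "\<exists>C>0. \<forall>a j. invertible (a j) \<longrightarrow> (\<forall>s\<in>ell p. ell_mass p s \<le> C * Lp_mass p (synthesis p a b \<psi> j s))"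
    if cs: "compactly_supported \<psi>"
  proof -
    obtain C where C: "C > 0" "\<And>s. s \<in> ell p \<Longrightarrow> ell_mass p s \<le> C * Lp_mass p (lattice_synthesis ?\<phi> s)"
      using lattice_synthesis_lower_bound[OF p \<phi> compactly_supported_matrix[OF b cs] nz] by blast
    show ?thesis
      by (rule exI[of _ "C / \<bar>det b\<bar>"]) (use C det synthesis_Lp(2)[OF p b _ \<psi>] in auto)
  qed
  show ?thesis
  proof (intro conjI impI)
    show "\<forall>a. expanding_dilations a \<longrightarrow> (\<forall>j>0. Lp_synthesis p a b \<psi> j \<in> ell p \<rightarrow> Lp p \<and>
                   inj_on (Lp_synthesis p a b \<psi> j) (ell p))"
      using into inj inva by blast
    assume "compactly_supported \<psi>"
    then obtain C where C: "C > 0"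
      and lower: "\<And>a j s. invertible (a j) \<Longrightarrow> s \<in> ell p \<Longrightarrow> ell_mass p s \<le> C * Lp_mass p (synthesis p a b \<psi> j s)"
      using compact by blast
    show "\<exists>C\<^sub>1>0. \<exists>C\<^sub>2>0. \<forall>a. expanding_dilations a \<longrightarrow>
               (\<forall>j>0. \<forall>s \<in> ell p.
                  C\<^sub>1 * Lp_norm p (synthesis p a b \<psi> j s) \<le> ell_norm p s \<and>
                  ell_norm p s \<le> C\<^sub>2 * Lp_norm p (synthesis p a b \<psi> j s))"
    proof (intro exI conjI allI impI ballI)
      \<comment> \<open>The mass bounds hold with K and C; taking 1/p-th powers turns them into the
        norm constants.\<close>
      show "(1 / K) powr (1 / p) > 0" "C powr (1 / p) > 0" using K C by auto
      fix a :: "nat \<Rightarrow> real ^ 'n ^ 'n" and j and s :: "int ^ 'n \<Rightarrow> complex" assume a: "expanding_dilations a" "0 < (j::nat)" and s: "s \<in> ell p"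
      note a = inva[OF a]
      have "1 / K * Lp_mass p (synthesis p a b \<psi> j s) \<le> ell_mass p s"
        using upper[where a = a and j = j, OF a s] K by (simp add: field_simps)
      then have "(1 / K * Lp_mass p (synthesis p a b \<psi> j s)) powr (1 / p) \<le> ell_mass p s powr (1 / p)"
        using p K by (intro powr_mono2 mult_nonneg_nonneg Lp_mass_nonneg) auto
      then show "(1 / K) powr (1 / p) * Lp_norm p (synthesis p a b \<psi> j s) \<le> ell_norm p s"
        using K by (simp only: Lp_norm_eq ell_norm_eq powr_mult)
      have "ell_mass p s powr (1 / p) \<le> (C * Lp_mass p (synthesis p a b \<psi> j s)) powr (1 / p)"
        using p lower[where a = a and j = j, OF a s] ell_mass_nonneg by (intro powr_mono2) auto
      then show "ell_norm p s \<le> C powr (1 / p) * Lp_norm p (synthesis p a b \<psi> j s)"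
        by (simp only: Lp_norm_eq ell_norm_eq powr_mult)
    qed
    show "\<forall>a. expanding_dilations a \<longrightarrow> (\<forall>j>0. closedin (Lp_topology p) (Lp_synthesis p a b \<psi> j ` ell p))"
    proof (intro allI impI)
      fix a :: "nat \<Rightarrow> real ^ 'n ^ 'n" and j :: nat assume "expanding_dilations a" "j > 0"
      then have a: "invertible (a j)" by (rule inva)
      show "closedin (Lp_topology p) (Lp_synthesis p a b \<psi> j ` ell p)"
        unfolding Lp_synthesis_def[abs_def]
        by (rule closed_range[where C = C and K = K])
           (use p upper[where a = a and j = j, OF a] lower[where a = a and j = j, OF a] synthesis_Lp(1)[where a = a and j = j, OF p b a \<psi>] synthesis_diff[where a = a and j = j, OF p b a \<psi>] in auto)
    qed
  qed
qed

end
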